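(* Suppose that $G$ and $G'$ are trees, and $\varphi=(\varphi_0,\hat\varphi)$ is a pair consisting of an involutive function $\varphi_0\colon A_G\to A_{G'}$ and a function $\hat\varphi\colon\mathrm{Emb}(G)\to\mathrm{Emb}(G')$ which satisfy $\partial(\hat\varphi[h])=(\mathbb N\varphi_0)(\partial[h])$ in $\mathbb NA_{G'}$ for every $[h]\in\mathrm{Emb}(G)$. Then $\varphi$ is a new graph map if and only if the following holds: if two subtrees $S,T$ of $G$ overlap, then so do $\hat\varphi(S)$ and $\hat\varphi(T)$, and in this case (a) $\hat\varphi(S\cap T)=\hat\varphi(S)\cap\hat\varphi(T)$, and (b) $\hat\varphi(S\cup T)=\hat\varphi(S)\cup\hat\varphi(T)$.
   Context: A graph $G$ consists of finite sets $A_G$ (arcs) and $V_G$ (vertices), a fixpoint-free involution $a\mapsto a^\dagger$ on $A_G$, a subset $D_G\subseteq A_G$, and a function $t\colon D_G\to V_G$. For $v\in V_G$, $\mathrm{nb}(v)=t^{-1}(v)$; the boundary is $\partial(G)=A_G\setminus D_G$; edges are $\dagger$-orbits $[a,a^\dagger]$, internal if $a,a^\dagger\in D_G$. Connected means non-empty and not a disjoint union of two non-empty graphs. The edge graph $\updownarrow$ has two arcs interchanged by $\dagger$ and $D=V=\varnothing$. A tree is a connected graph that is simply connected (contains no cycles); equivalently, a connected graph with $V_G=\varnothing$, or with exactly $|V_G|-1$ internal edges. An étale map $f\colon H\to G$ consists of functions on $A$, $D$, $V$ compatible with the involutions, inclusions and $t$, restricting to bijections $\mathrm{nb}(v)\to\mathrm{nb}(f(v))$.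 An embedding is an étale map between connected graphs, injective on vertices. $\mathrm{Emb}(G)$ is the set of classes $[f]$ of embeddings with codomain $G$ ($f\sim h$ iff $f=hz$, $z$ an isomorphism), ordered by $[h]\le[k]$ iff $h=kj$ for some embedding $j$. $[f\colon H\to G]$ is an edge if $H\cong\updownarrow$. $\mathbb NS$ is the free commutative monoid on $S$, with subsets of a finite $S$ identified with repetition-free elements; $\partial([f])=f(\partial(H))\subseteq A_G$. "Involutive function" means compatible with $\dagger$. New graph maps: $\ell\colon L\to G$ is a union of embeddings $h\colon H\to G$ and $k\colon K\to G$ if $[h],[k]\le[\ell]$ and $\ell(V_L)=h(V_H)\cup k(V_K)$; $h,k$ are vertex disjoint if $h(V_H)\cap k(V_K)=\varnothing$. A new graph map $G\to G'$ is a pair $(\varphi_0,\hat\varphi)$, with $\varphi_0\colon A_G\to A_{G'}$ involutive and $\hat\varphi\colon\mathrm{Emb}(G)\to\mathrm{Emb}(G')$ a function, such that: (i) $\hat\varphi$ sends edges to edges; (ii) if $[\ell]$ is a union of $[h]$ and $[k]$, then $\hat\varphi[\ell]$ is a union of $\hat\varphi[h]$ and $\hat\varphi[k]$; (iii) $\hat\varphi$ takes vertex disjoint pairs to vertex disjoint pairs; (iv) $\partial(\hat\varphi[h])=(\mathbb N\varphi_0)(\partial[h])$ for all $[h]$. Subtrees: a subtree $S$ of a tree $T$ is a triple of subsets $A_S\subseteq A_T$, $D_S\subseteq D_T$, $V_S\subseteq V_T$ such that $A_S$ is closed under $\dagger$, $D_S\subseteq A_S$, $D_S=t^{-1}(V_S)$,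 and the resulting graph $S$ is connected. Sending a subtree to its inclusion gives a bijection between subtrees of $T$ and $\mathrm{Emb}(T)$; through this bijection $\hat\varphi(S)$ denotes the subtree of $G'$ corresponding to $\hat\varphi[S\to G]$. Intersections $S\cap T$ and unions $S\cup T$ of subtrees are formed componentwise on the three sets; two subtrees overlap if $S\cap T$ is non-empty (in which case $S\cap T$ and $S\cup T$ are subtrees). *)

theory Defs
  imports Main "HOL-Library.FuncSet" "HOL-Library.Multiset"
begin

text \<open>
  \<^term>\<open>Arc G\<close>, \<^term>\<open>Att G\<close> and \<^term>\<open>Vert G\<close> are the sets $A_G$, $D_G$ and $V_G$;
  the values of \<^term>\<open>dag G\<close> outside $A_G$ and of \<^term>\<open>tgt G\<close> outside $D_G$ are irrelevant.
\<close>

record ('a, 'v) graph_data =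
  Arc :: "'a set"
  Att :: "'a set"
  Vert :: "'v set"
  dag :: "'a \<Rightarrow> 'a"
  tgt :: "'a \<Rightarrow> 'v"

definition is_graph :: "('a, 'v) graph_data \<Rightarrow> bool" where
  "is_graph G \<longleftrightarrow>
     finite (Arc G) \<and> finite (Vert G) \<and>
     (\<forall>a\<in>Arc G. dag G a \<in> Arc G \<and> dag G a \<noteq> a \<and> dag G (dag G a) = a) \<and>
     Att G \<subseteq> Arc G \<and>
     tgt G \<in> Att G \<rightarrow> Vert G"

definition nb :: "('a, 'v) graph_data \<Rightarrow> 'v \<Rightarrow> 'a set" where
  "nb G v = {d \<in> Att G. tgt G d = v}"

definition bdry :: "('a, 'v) graph_data \<Rightarrow> 'a set" where
  "bdry G = Arc G - Att G"

definition edge_of :: "('a, 'v) graph_data \<Rightarrow> 'a \<Rightarrow> 'a set" where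
  "edge_of G a = {a, dag G a}"

definition nonempty_graph :: "('a, 'v) graph_data \<Rightarrow> bool" where
  "nonempty_graph G \<longleftrightarrow> Arc G \<noteq> {} \<or> Vert G \<noteq> {}"

definition is_disjoint_union ::
  "('a, 'v) graph_data \<Rightarrow> ('a, 'v) graph_data \<Rightarrow> ('a, 'v) graph_data \<Rightarrow> bool" where
  "is_disjoint_union G H K \<longleftrightarrow>
     Arc H \<inter> Arc K = {} \<and> Vert H \<inter> Vert K = {} \<and>
     Arc G = Arc H \<union> Arc K \<and> Att G = Att H \<union> Att K \<and> Vert G = Vert H \<union> Vert K \<and>
     (\<forall>a\<in>Arc H. dag G a = dag H a) \<and> (\<forall>a\<in>Arc K. dag G a = dag K a) \<and>
     (\<forall>d\<in>Att H. tgt G d = tgt H d) \<and> (\<forall>d\<in>Att K. tgt G d = tgt K d)"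

definition connected_graph :: "('a, 'v) graph_data \<Rightarrow> bool" where
  "connected_graph G \<longleftrightarrow>
     is_graph G \<and> nonempty_graph G \<and>
     \<not> (\<exists>H K. is_graph H \<and> is_graph K \<and> nonempty_graph H \<and> nonempty_graph K \<and>
              is_disjoint_union G H K)"

text \<open>
  A cycle is recorded by the arcs it leaves its vertices along.  Distinctness of the edges rules
  out running back and forth along one edge (length 2); a cycle of length 1 is a loop at a vertex.
\<close>

definition is_cycle :: "('a, 'v) graph_data \<Rightarrow> 'a list \<Rightarrow> bool" where
  "is_cycle G as \<longleftrightarrow>
     as \<noteq> [] \<and>
     (\<forall>a\<in>set as. a \<in> Att G \<and> dag G a \<in> Att G) \<and>
     distinct (map (tgt G) as) \<and> distinct (map (edge_of G) as) \<and>
     (\<forall>i<length as. tgt G (dag G (as ! i)) = tgt G (as ! (Suc i mod length as)))"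

definition is_tree :: "('a, 'v) graph_data \<Rightarrow> bool" where
  "is_tree G \<longleftrightarrow> connected_graph G \<and> (\<nexists>as. is_cycle G as)"

definition edge_graph :: "(bool, unit) graph_data" where
  "edge_graph = \<lparr>Arc = UNIV, Att = {}, Vert = {}, dag = Not, tgt = (\<lambda>_. ())\<rparr>"

text \<open>
  A map of graphs is given by its functions on arcs and on vertices; compatibility with the
  inclusions forces the function $D_H \to D_G$ to be the restriction of the function on arcs.
  Equality of maps is equality on the arcs and vertices of the domain.
\<close>

type_synonym ('a, 'v, 'b, 'w) gmap = "('a \<Rightarrow> 'b) \<times> ('v \<Rightarrow> 'w)"

definition gmap_eq ::
  "('a, 'v) graph_data \<Rightarrow> ('a, 'v, 'b, 'w) gmap \<Rightarrow> ('a, 'v, 'b, 'w) gmap \<Rightarrow> bool" where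
  "gmap_eq H f g \<longleftrightarrow> (\<forall>a\<in>Arc H. fst f a = fst g a) \<and> (\<forall>v\<in>Vert H. snd f v = snd g v)"

definition gmap_comp ::
  "('b, 'w, 'c, 'x) gmap \<Rightarrow> ('a, 'v, 'b, 'w) gmap \<Rightarrow> ('a, 'v, 'c, 'x) gmap" where
  "gmap_comp g f = (fst g \<circ> fst f, snd g \<circ> snd f)"

definition involutive_on ::
  "('a, 'v) graph_data \<Rightarrow> ('b, 'w) graph_data \<Rightarrow> ('a \<Rightarrow> 'b) \<Rightarrow> bool" where
  "involutive_on H G f \<longleftrightarrow> f \<in> Arc H \<rightarrow> Arc G \<and> (\<forall>a\<in>Arc H. f (dag H a) = dag G (f a))"

definition etale ::
  "('a, 'v) graph_data \<Rightarrow> ('b, 'w) graph_data \<Rightarrow> ('a, 'v, 'b, 'w) gmap \<Rightarrow> bool" where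
  "etale H G f \<longleftrightarrow>
     is_graph H \<and> is_graph G \<and>
     involutive_on H G (fst f) \<and>
     fst f \<in> Att H \<rightarrow> Att G \<and>
     snd f \<in> Vert H \<rightarrow> Vert G \<and>
     (\<forall>d\<in>Att H. tgt G (fst f d) = snd f (tgt H d)) \<and>
     (\<forall>v\<in>Vert H. bij_betw (fst f) (nb H v) (nb G (snd f v)))"

definition graph_iso ::
  "('a, 'v) graph_data \<Rightarrow> ('b, 'w) graph_data \<Rightarrow> ('a, 'v, 'b, 'w) gmap \<Rightarrow> bool" where
  "graph_iso H G z \<longleftrightarrow>
     etale H G z \<and> bij_betw (fst z) (Arc H) (Arc G) \<and> bij_betw (fst z) (Att H) (Att G) \<and>
     bij_betw (snd z) (Vert H) (Vert G)"

definition embedding ::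
  "('a, 'v) graph_data \<Rightarrow> ('b, 'w) graph_data \<Rightarrow> ('a, 'v, 'b, 'w) gmap \<Rightarrow> bool" where
  "embedding H G f \<longleftrightarrow>
     etale H G f \<and> connected_graph H \<and> connected_graph G \<and> inj_on (snd f) (Vert H)"

text \<open>
  As graphs are finite, every embedding is isomorphic to one whose domain has natural numbers as
  arcs and vertices, so the class $[f]$ is represented by its members with such a domain.
  In \<^term>\<open>emb_class G H f\<close> the graph \<^term>\<open>H\<close> may still have arcs and vertices of any type.
\<close>

type_synonym ('b, 'w) emb = "((nat, nat) graph_data \<times> (nat, nat, 'b, 'w) gmap) set"

definition emb_class ::
  "('b, 'w) graph_data \<Rightarrow> ('a, 'v) graph_data \<Rightarrow> ('a, 'v, 'b, 'w) gmap \<Rightarrow> ('b, 'w) emb" where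
  "emb_class G H f =
     {(K, k). embedding K G k \<and> (\<exists>z. graph_iso K H z \<and> gmap_eq K k (gmap_comp f z))}"

definition Emb :: "('b, 'w) graph_data \<Rightarrow> ('b, 'w) emb set" where
  "Emb G = {emb_class G H f | (H :: (nat, nat) graph_data) f. embedding H G f}"

text \<open>
  The following notions do not depend on the representatives of the classes.
\<close>

definition emb_le :: "('b, 'w) emb \<Rightarrow> ('b, 'w) emb \<Rightarrow> bool" where
  "emb_le x y \<longleftrightarrow>
     (\<exists>(H, h)\<in>x. \<exists>(K, k)\<in>y. \<exists>j. embedding H K j \<and> gmap_eq H h (gmap_comp k j))"

definition emb_is_edge :: "('b, 'w) emb \<Rightarrow> bool" where
  "emb_is_edge x \<longleftrightarrow> (\<exists>(H, h)\<in>x. \<exists>z. graph_iso H edge_graph z)"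

definition emb_verts :: "('b, 'w) emb \<Rightarrow> 'w set" where
  "emb_verts x = (\<Union>(H, h)\<in>x. snd h ` Vert H)"

definition emb_bdry :: "('b, 'w) emb \<Rightarrow> 'b set" where
  "emb_bdry x = (\<Union>(H, h)\<in>x. fst h ` bdry H)"

definition emb_is_union :: "('b, 'w) emb \<Rightarrow> ('b, 'w) emb \<Rightarrow> ('b, 'w) emb \<Rightarrow> bool" where
  "emb_is_union l h k \<longleftrightarrow>
     emb_le h l \<and> emb_le k l \<and> emb_verts l = emb_verts h \<union> emb_verts k"

definition emb_vertex_disjoint :: "('b, 'w) emb \<Rightarrow> ('b, 'w) emb \<Rightarrow> bool" where
  "emb_vertex_disjoint h k \<longleftrightarrow> emb_verts h \<inter> emb_verts k = {}"

text \<open>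
  The free commutative monoid on $S$ is rendered by multisets, a finite subset $X$ being
  identified with \<^term>\<open>mset_set X\<close>.
\<close>

definition bdry_compatible ::
  "('a, 'v) graph_data \<Rightarrow> ('a \<Rightarrow> 'b) \<Rightarrow> (('a, 'v) emb \<Rightarrow> ('b, 'w) emb) \<Rightarrow> bool" where
  "bdry_compatible G \<phi>\<^sub>0 \<phi> \<longleftrightarrow>
     (\<forall>h\<in>Emb G. mset_set (emb_bdry (\<phi> h)) = image_mset \<phi>\<^sub>0 (mset_set (emb_bdry h)))"

definition new_graph_map ::
  "('a, 'v) graph_data \<Rightarrow> ('b, 'w) graph_data \<Rightarrow>
     ('a \<Rightarrow> 'b) \<times> (('a, 'v) emb \<Rightarrow> ('b, 'w) emb) \<Rightarrow> bool" where
  "new_graph_map G G' \<phi> \<longleftrightarrow>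
     involutive_on G G' (fst \<phi>) \<and>
     snd \<phi> \<in> Emb G \<rightarrow> Emb G' \<and>
     (\<forall>h\<in>Emb G. emb_is_edge h \<longrightarrow> emb_is_edge (snd \<phi> h)) \<and>
     (\<forall>l\<in>Emb G. \<forall>h\<in>Emb G. \<forall>k\<in>Emb G.
        emb_is_union l h k \<longrightarrow> emb_is_union (snd \<phi> l) (snd \<phi> h) (snd \<phi> k)) \<and>
     (\<forall>h\<in>Emb G. \<forall>k\<in>Emb G.
        emb_vertex_disjoint h k \<longrightarrow> emb_vertex_disjoint (snd \<phi> h) (snd \<phi> k)) \<and>
     bdry_compatible G (fst \<phi>) (snd \<phi>)"

type_synonym ('a, 'v) sub = "'a set \<times> 'a set \<times> 'v set"

fun sub_graph :: "('a, 'v) graph_data \<Rightarrow> ('a, 'v) sub \<Rightarrow> ('a, 'v) graph_data" where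
  "sub_graph T (A, D, V) = T\<lparr>Arc := A, Att := D, Vert := V\<rparr>"

definition subtrees :: "('a, 'v) graph_data \<Rightarrow> ('a, 'v) sub set" where
  "subtrees T =
     {(A, D, V). A \<subseteq> Arc T \<and> D \<subseteq> Att T \<and> V \<subseteq> Vert T \<and>
        (\<forall>a\<in>A. dag T a \<in> A) \<and> D \<subseteq> A \<and> D = {d \<in> Att T. tgt T d \<in> V} \<and>
        connected_graph (sub_graph T (A, D, V))}"

fun sub_inter :: "('a, 'v) sub \<Rightarrow> ('a, 'v) sub \<Rightarrow> ('a, 'v) sub" (infixl "\<inter>\<^sub>s" 70) where
  "(A, D, V) \<inter>\<^sub>s (A', D', V') = (A \<inter> A', D \<inter> D', V \<inter> V')"

fun sub_union :: "('a, 'v) sub \<Rightarrow> ('a, 'v) sub \<Rightarrow> ('a, 'v) sub" (infixl "\<union>\<^sub>s" 65) where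
  "(A, D, V) \<union>\<^sub>s (A', D', V') = (A \<union> A', D \<union> D', V \<union> V')"

definition overlap :: "('a, 'v) sub \<Rightarrow> ('a, 'v) sub \<Rightarrow> bool" where
  "overlap S T \<longleftrightarrow> S \<inter>\<^sub>s T \<noteq> ({}, {}, {})"

definition sub_emb :: "('a, 'v) graph_data \<Rightarrow> ('a, 'v) sub \<Rightarrow> ('a, 'v) emb" where
  "sub_emb T S = emb_class T (sub_graph T S) (id, id)"

text \<open>
  For a tree $T$, \<^term>\<open>sub_emb T\<close> is a bijection from \<^term>\<open>subtrees T\<close> to \<^term>\<open>Emb T\<close>, through
  which a function on classes of embeddings acts on subtrees.
\<close>

definition on_subtrees ::
  "('a, 'v) graph_data \<Rightarrow> ('b, 'w) graph_data \<Rightarrow> (('a, 'v) emb \<Rightarrow> ('b, 'w) emb) \<Rightarrow>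
     ('a, 'v) sub \<Rightarrow> ('b, 'w) sub" where
  "on_subtrees G G' \<phi> S = the_inv_into (subtrees G') (sub_emb G') (\<phi> (sub_emb G S))"

end

theory Submission imports Defs begin

text \<open>
  Under the bijection with \<^term>\<open>Emb G\<close>, a class is a union of two others exactly if the two
  subtrees overlap and their union is the third, so preservation of unions is condition (b)
  together with preservation of overlaps.  Given (a) and (b), two vertex disjoint subtrees remain
  so: grow one of them, star by star, until it meets the other in a single edge, and use that edges
  go to edges because their boundary has the form $\{b, b^\dagger\}$.  Conversely, by (ii) the
  vertices of the image of $S$ are the union over $v \in S$ of those of the image of the star of
  $v$, and these are disjoint for different $v$ by (iii); so the image of $S \cap T$ and the
  intersection of the images have the same vertices, and (a) follows.
\<close>

section \<open>Connectedness\<close>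

text \<open>A subtree is determined by its arcs and vertices, and by its vertices alone unless it is
  a single edge. Hence edges are treated apart throughout, and two subtrees are compared by equality
  of vertices together with one inclusion of arcs. The inclusion carries information exactly when
  there are no vertices: vertex sets cannot tell one edge from another. Acyclicity enters through
  bridges: after removal of an internal edge its two ends are no longer joined. This makes
  embeddings injective on arcs, which does not follow from injectivity on vertices in general, so
  that a class of embeddings can be replaced by the image of any member. It also makes a subtree
  meet the star of an outside vertex in at most one edge, and that is why intersections of
  overlapping subtrees are connected. Connectedness is used in the form that a non-empty set of
  vertices closed under adjacency is everything; walks occur only to produce a cycle from an edge
  that is not a bridge.\<close>

definition atts :: "('a, 'v) graph_data \<Rightarrow> 'v set \<Rightarrow> 'a set" where
  "atts G V = {d \<in> Att G. tgt G d \<in> V}"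

text \<open>Since \<open>c\<close> may be either arc of an edge, this one-sided condition says, for
  \<open>X\<close> inside \<open>V\<close>, that no internal edge joins \<open>X\<close> to
  \<open>V - X\<close>.\<close>

definition adj_closed :: "('a, 'v) graph_data \<Rightarrow> 'v set \<Rightarrow> 'v set \<Rightarrow> bool" where
  "adj_closed G V X \<longleftrightarrow>
     (\<forall>c. c \<in> Att G \<and> dag G c \<in> Att G \<and> tgt G c \<in> X \<and> tgt G (dag G c) \<in> V \<longrightarrow>
        tgt G (dag G c) \<in> X)"

text \<open>
  Connectedness of the subgraph of \<^term>\<open>G\<close> with arcs \<^term>\<open>A\<close> and vertices
  \<^term>\<open>V\<close>, provided that \<^term>\<open>A\<close> is closed under \<^term>\<open>dag G\<close> and contains
  \<^term>\<open>atts G V\<close>.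
\<close>

definition linked :: "('a, 'v) graph_data \<Rightarrow> 'a set \<Rightarrow> 'v set \<Rightarrow> bool" where
  "linked G A V \<longleftrightarrow>
     (if V = {} then \<exists>a. A = {a, dag G a}
      else (\<forall>a\<in>A. a \<in> atts G V \<or> dag G a \<in> atts G V) \<and>
           (\<forall>X. X \<subseteq> V \<and> X \<noteq> {} \<and> adj_closed G V X \<longrightarrow> X = V))"

lemma is_graphD:
  assumes "is_graph G"
  shows "finite (Arc G)" "finite (Vert G)" "Att G \<subseteq> Arc G"
    "a \<in> Arc G \<Longrightarrow> dag G a \<in> Arc G" "a \<in> Arc G \<Longrightarrow> dag G a \<noteq> a"
    "a \<in> Arc G \<Longrightarrow> dag G (dag G a) = a" "d \<in> Att G \<Longrightarrow> tgt G d \<in> Vert G"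
  using assms unfolding is_graph_def by auto

lemma atts_Vert: "is_graph G \<Longrightarrow> atts G (Vert G) = Att G"
  by (auto simp: atts_def is_graphD)

text \<open>Cutting \<open>G\<close> along \<open>B\<close> and \<open>X\<close> leaves two graphs,
  because \<open>BX\<close> puts each attached arc on the side of its target. If both were
  non-empty, \<open>G\<close> would be their disjoint union.\<close>

lemma connected_graph_no_split:
  assumes con: "connected_graph G"
    and B: "B \<subseteq> Arc G" "\<forall>a\<in>B. dag G a \<in> B" and X: "X \<subseteq> Vert G"
    and BX: "\<forall>d\<in>Att G. d \<in> B \<longleftrightarrow> tgt G d \<in> X" and ne: "B \<noteq> {} \<or> X \<noteq> {}"
  shows "B = Arc G \<and> X = Vert G"
proof (rule ccontr)
  assume neq: "\<not> ?thesis"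
  have G: "is_graph G" using con by (simp add: connected_graph_def)
  define H where "H = G\<lparr>Arc := B, Att := Att G \<inter> B, Vert := X\<rparr>"
  define K where "K = G\<lparr>Arc := Arc G - B, Att := Att G - B, Vert := Vert G - X\<rparr>"
  have H: "is_graph H"
    using G B X BX unfolding is_graph_def H_def by (auto intro: finite_subset)
  have "dag G a \<notin> B" if "a \<in> Arc G - B" for a
    using that B(2) is_graphD(6)[OF G, of a] by (metis DiffE)
  then have K: "is_graph K"
    using G B X BX unfolding is_graph_def K_def by auto
  have "nonempty_graph H" "nonempty_graph K"
    using ne neq B(1) X by (auto simp: nonempty_graph_def H_def K_def)
  moreover have "is_disjoint_union G H K"
    using B X BX is_graphD(3)[OF G] unfolding is_disjoint_union_def H_def K_def by auto
  ultimately show False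
    using con H K unfolding connected_graph_def by blast
qed

text \<open>An edge with neither arc attached splits off, so it is the whole graph. A closed set of
  vertices, taken together with the edges that touch it, splits off as well.\<close>

lemma connected_graph_imp_linked:
  assumes con: "connected_graph G"
  shows "linked G (Arc G) (Vert G)"
proof -
  have G: "is_graph G" and ne: "nonempty_graph G" using con by (simp_all add: connected_graph_def)
  note g = is_graphD[OF G]
  have edge: "Arc G = {a, dag G a} \<and> Vert G = {}"
    if "a \<in> Arc G" "a \<notin> Att G" "dag G a \<notin> Att G" for a
    using connected_graph_no_split[OF con, of "{a, dag G a}" "{}"] that g by auto
  show ?thesis
  proof (cases "Vert G = {}")
    case True
    then have "Att G = {}" using g by auto
    moreover obtain a where "a \<in> Arc G" using ne True by (auto simp: nonempty_graph_def)
    ultimately show ?thesis using edge True by (auto simp: linked_def)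
  next
    case False
    have "X = Vert G" if X: "X \<subseteq> Vert G" "X \<noteq> {}" "adj_closed G (Vert G) X" for X
    proof -
      define B where "B = {a \<in> Arc G. a \<in> atts G X \<or> dag G a \<in> atts G X}"
      have "tgt G d \<in> X" if "d \<in> Att G" "d \<in> B" for d
        using that X(3) g(3,4,6,7) unfolding B_def atts_def adj_closed_def
        by (smt (verit) mem_Collect_eq subsetD)
      moreover have "d \<in> B" if "d \<in> Att G" "tgt G d \<in> X" for d
        using that g by (auto simp: B_def atts_def)
      ultimately have "\<forall>d\<in>Att G. d \<in> B \<longleftrightarrow> tgt G d \<in> X" by blast
      moreover have "B \<subseteq> Arc G" "\<forall>a\<in>B. dag G a \<in> B" using g(4,6) by (auto simp: B_def)
      ultimately show ?thesis using connected_graph_no_split[OF con] X(1,2) by blast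
    qed
    moreover have "a \<in> Att G \<or> dag G a \<in> Att G" if "a \<in> Arc G" for a
      using edge that False by auto
    ultimately show ?thesis using False by (auto simp: linked_def atts_Vert[OF G])
  qed
qed

text \<open>If there are vertices, every edge has an attached arc, so both parts of a splitting
  contain vertices; but the vertices of one part are closed under adjacency. Without vertices, both
  parts would contain the only edge.\<close>

lemma linked_imp_connected_graph:
  assumes G: "is_graph G" and lin: "linked G (Arc G) (Vert G)"
  shows "connected_graph G"
proof -
  note g = is_graphD[OF G]
  have "nonempty_graph G"
    using lin by (auto simp: nonempty_graph_def linked_def split: if_splits)
  moreover have False
    if HK_graph: "is_graph H" "is_graph K" and HK_ne: "nonempty_graph H" "nonempty_graph K"
      and dis: "is_disjoint_union G H K" for H K
  proof -
    note h = is_graphD[OF HK_graph(1)] and k = is_graphD[OF HK_graph(2)]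
    note d = dis[unfolded is_disjoint_union_def]
    show False
    proof (cases "Vert G = {}")
      case True
      then obtain a where a: "Arc G = {a, dag G a}" using lin by (auto simp: linked_def)
      have "Arc H \<noteq> {}" "Arc K \<noteq> {}" using HK_ne True d by (auto simp: nonempty_graph_def)
      then obtain b c where bc: "b \<in> Arc H" "c \<in> Arc K" by auto
      then have "b \<in> {a, dag G a}" "c \<in> {a, dag G a}" "dag G b \<in> Arc H" "dag G c \<in> Arc K"
        using a d h k by auto
      moreover have "dag G (dag G a) = a" using a g by auto
      ultimately show False using bc d by auto
    next
      case False
      have HK: "Arc H \<inter> Arc K = {}" "Vert H \<inter> Vert K = {}" using d by auto
      have attH: "c \<in> Att H" if "c \<in> Att G" "c \<in> Arc H" for c
        using that d k by auto
      have attK: "c \<in> Att K" if "c \<in> Att G" "c \<in> Arc K" for c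
        using that d h by auto
      have arc: "a \<in> Att G \<or> dag G a \<in> Att G" if "a \<in> Arc G" for a
        using lin that False by (auto simp: linked_def atts_def)
      have VH: "Vert H \<noteq> {}"
      proof
        assume "Vert H = {}"
        then obtain a where "a \<in> Arc H" using HK_ne(1) by (auto simp: nonempty_graph_def)
        then have "a \<in> Att H \<or> dag G a \<in> Att H"
          using arc[of a] attH d h(4) by auto
        then show False using h(7) \<open>Vert H = {}\<close> by blast
      qed
      have VK: "Vert K \<noteq> {}"
      proof
        assume "Vert K = {}"
        then obtain a where "a \<in> Arc K" using HK_ne(2) by (auto simp: nonempty_graph_def)
        then have "a \<in> Att K \<or> dag G a \<in> Att K"
          using arc[of a] attK d k(4) by auto
        then show False using k(7) \<open>Vert K = {}\<close> by blast
      qed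
      have "adj_closed G (Vert G) (Vert H)"
        unfolding adj_closed_def
      proof (intro allI impI)
        fix c assume c: "c \<in> Att G \<and> dag G c \<in> Att G \<and> tgt G c \<in> Vert H \<and> tgt G (dag G c) \<in> Vert G"
        have "c \<notin> Att K" using c d k(7)[of c] by (metis disjoint_iff)
        then have "c \<in> Att H" using c d by auto
        then have "dag G c \<in> Arc H" using d h(3,4) by (metis subsetD)
        then have "dag G c \<in> Att H" using attH c by blast
        then show "tgt G (dag G c) \<in> Vert H" using d h(7) by metis
      qed
      then have "Vert H = Vert G" using lin False VH d by (simp add: linked_def)
      then show False using VK d by auto
    qed
  qed
  ultimately show ?thesis using G unfolding connected_graph_def by blast
qed

section \<open>Subtrees\<close>

abbreviation sub_arcs :: "('a, 'v) sub \<Rightarrow> 'a set" where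
  "sub_arcs S \<equiv> fst S"

abbreviation sub_verts :: "('a, 'v) sub \<Rightarrow> 'v set" where
  "sub_verts S \<equiv> snd (snd S)"

text \<open>The middle component of a subtree is left out, since it is forced to be
  \<open>atts G V\<close>.\<close>

definition stree :: "('a, 'v) graph_data \<Rightarrow> 'a set \<Rightarrow> 'v set \<Rightarrow> bool" where
  "stree G A V \<longleftrightarrow>
     A \<subseteq> Arc G \<and> V \<subseteq> Vert G \<and> (\<forall>a\<in>A. dag G a \<in> A) \<and> atts G V \<subseteq> A \<and> linked G A V"

text \<open>The attached arcs and the adjacency on \<open>V\<close> are the same in the subgraph as
  in \<open>G\<close>, so connectedness of the subgraph can be tested by \<open>linked\<close> in
  \<open>G\<close> itself.\<close>

lemma subtrees_iff:
  assumes G: "is_graph G"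
  shows "S \<in> subtrees G \<longleftrightarrow>
    stree G (sub_arcs S) (sub_verts S) \<and> S = (sub_arcs S, atts G (sub_verts S), sub_verts S)"
proof -
  obtain A D V where S: "S = (A, D, V)" by (cases S) auto
  note g = is_graphD[OF G]
  have con: "connected_graph (sub_graph G (A, D, V)) \<longleftrightarrow> linked G A V"
    if *: "A \<subseteq> Arc G" "V \<subseteq> Vert G" "\<forall>a\<in>A. dag G a \<in> A" "D = atts G V" "D \<subseteq> A"
  proof -
    let ?H = "sub_graph G (A, D, V)"
    have H: "is_graph ?H"
      using * G by (auto simp: is_graph_def atts_def intro: finite_subset)
    have at: "atts ?H V = atts G V" using * by (auto simp: atts_def)
    have "adj_closed ?H V X \<longleftrightarrow> adj_closed G V X" if "X \<subseteq> V" for X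
      using that * by (fastforce simp: adj_closed_def atts_def)
    then have "linked ?H A V \<longleftrightarrow> linked G A V"
      unfolding linked_def at by (auto cong: conj_cong)
    then show ?thesis
      using connected_graph_imp_linked[of ?H] linked_imp_connected_graph[OF H] by auto
  qed
  have "S \<in> subtrees G \<longleftrightarrow> A \<subseteq> Arc G \<and> V \<subseteq> Vert G \<and> (\<forall>a\<in>A. dag G a \<in> A) \<and> D \<subseteq> A \<and>
      D = atts G V \<and> D \<subseteq> Att G \<and> connected_graph (sub_graph G (A, D, V))"
    unfolding S subtrees_def atts_def by (simp del: sub_graph.simps) blast
  moreover have "atts G V \<subseteq> Att G" by (auto simp: atts_def)
  ultimately show ?thesis
    using con unfolding stree_def by (simp only: S fst_conv snd_conv prod.inject) blast
qed

lemma streeD: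
  assumes "stree G A V"
  shows "A \<subseteq> Arc G" "V \<subseteq> Vert G" "a \<in> A \<Longrightarrow> dag G a \<in> A" "atts G V \<subseteq> A"
    "d \<in> Att G \<Longrightarrow> tgt G d \<in> V \<Longrightarrow> d \<in> A"
    "V = {} \<Longrightarrow> \<exists>a. A = {a, dag G a}"
    "V \<noteq> {} \<Longrightarrow> a \<in> A \<Longrightarrow> a \<in> atts G V \<or> dag G a \<in> atts G V"
    "X \<subseteq> V \<Longrightarrow> X \<noteq> {} \<Longrightarrow> adj_closed G V X \<Longrightarrow> X = V"
  using assms by (auto simp: stree_def linked_def atts_def split: if_splits)

lemma stree_edge_eq:
  assumes G: "is_graph G" and S: "stree G A V" and a: "a \<in> A" "V = {}"
  shows "A = {a, dag G a}"
proof -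
  obtain b where b: "A = {b, dag G b}" using streeD(6)[OF S] a by auto
  moreover have "dag G (dag G b) = b" using is_graphD(6)[OF G] streeD(1)[OF S] b by auto
  ultimately show ?thesis using a by auto
qed

lemma stree_edge:
  assumes G: "is_graph G" and "a \<in> Arc G"
  shows "stree G {a, dag G a} {}"
  using assms is_graphD[OF G] by (auto simp: stree_def linked_def atts_def)

text \<open>Every edge has an end at a vertex of \<open>V\<close>, so the arcs are those attached to
  \<open>V\<close> and their mates.\<close>

lemma stree_arcs_eq:
  assumes G: "is_graph G" and "stree G A V" "stree G B V" "V \<noteq> {}"
  shows "A = B"
proof -
  have "A \<subseteq> B" if S: "stree G A V" and T: "stree G B V" for A B
  proof
    fix a assume a: "a \<in> A"
    then have "a \<in> atts G V \<or> dag G a \<in> atts G V" using streeD(7)[OF S] assms(4) by auto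
    moreover have "dag G (dag G a) = a" using is_graphD(6)[OF G] streeD(1)[OF S] a by auto
    ultimately show "a \<in> B" using streeD(3,4)[OF T] by (metis subsetD)
  qed
  then show ?thesis using assms by blast
qed

text \<open>The inclusion settles the case that \<open>stree_arcs_eq\<close> leaves open: two single
  edges, one contained in the other.\<close>

lemma stree_eqI:
  assumes G: "is_graph G" and S: "stree G A V" and T: "stree G B V" and "A \<subseteq> B"
  shows "A = B"
proof (cases "V = {}")
  case True
  then obtain a where "A = {a, dag G a}" using streeD(6)[OF S] by auto
  then show ?thesis using stree_edge_eq[OF G T, of a] assms(4) True by auto
qed (use stree_arcs_eq[OF G S T] in auto)

lemma stree_nonempty:
  assumes "stree G A V"
  shows "A \<noteq> {} \<or> V \<noteq> {}"
  using streeD(6)[OF assms] by auto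

lemma stree_whole:
  assumes "connected_graph G"
  shows "stree G (Arc G) (Vert G)"
proof -
  have G: "is_graph G" using assms by (simp add: connected_graph_def)
  show ?thesis
    using is_graphD[OF G] connected_graph_imp_linked[OF assms] by (auto simp: stree_def atts_def)
qed

text \<open>A closed set \<open>X\<close> contains each side that it meets, and from one side it
  reaches the other through a common vertex, or through a common edge with one end on each side. If
  one of the subtrees is an edge, the overlap puts it inside the other.\<close>

lemma stree_Un:
  assumes G: "is_graph G" and S: "stree G A V" and T: "stree G B W"
    and ov: "A \<inter> B \<noteq> {} \<or> V \<inter> W \<noteq> {}"
  shows "stree G (A \<union> B) (V \<union> W)"
proof (cases "V = {} \<or> W = {}")
  case True
  then obtain a where a: "a \<in> A" "a \<in> B" using ov by auto
  have "V = {} \<Longrightarrow> A \<subseteq> B" using stree_edge_eq[OF G S a(1)] streeD(3)[OF T a(2)] a by auto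
  moreover have "W = {} \<Longrightarrow> B \<subseteq> A" using stree_edge_eq[OF G T a(2)] streeD(3)[OF S a(1)] a by auto
  ultimately have "stree G (A \<union> B) (V \<union> W) \<longleftrightarrow> stree G B W \<or> stree G A V"
    using True S T by (auto simp: Un_absorb1 Un_absorb2)
  then show ?thesis using S T by auto
next
  case False
  note g = is_graphD[OF G]
  \<comment> \<open>Stated for arbitrary \<open>Y\<close> and \<open>Z\<close> because it is applied
    with the two subtrees in either order.\<close>
  have step: "Y \<subseteq> X \<and> Z \<inter> X \<noteq> {}"
    if X: "X \<inter> Y \<noteq> {}" "adj_closed G (Y \<union> Z) X" and S: "stree G A Y" and T: "stree G B Z"
      and ov: "A \<inter> B \<noteq> {} \<or> Y \<inter> Z \<noteq> {}" and ne: "Z \<noteq> {}" for X Y Z A B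
  proof -
    have "adj_closed G Y (X \<inter> Y)" using X(2) by (auto simp: adj_closed_def)
    then have YX: "Y \<subseteq> X" using streeD(8)[OF S, of "X \<inter> Y"] X(1) by auto
    have "Y \<noteq> {}" using X(1) by auto
    have "Z \<inter> X \<noteq> {}" if disj: "Y \<inter> Z = {}"
    proof -
      obtain a where a: "a \<in> A" "a \<in> B" using ov disj by auto
      have dd: "dag G (dag G a) = a" using a g streeD(1)[OF S] by auto
      have "a \<in> atts G Y \<or> dag G a \<in> atts G Y" "a \<in> atts G Z \<or> dag G a \<in> atts G Z"
        using a streeD(7)[OF S] streeD(7)[OF T] ne \<open>Y \<noteq> {}\<close> by auto
      then obtain b where "b \<in> atts G Y" "dag G b \<in> atts G Z"
        using dd disj unfolding atts_def by (metis (no_types, lifting) disjoint_iff mem_Collect_eq)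
      then show ?thesis using X(2) YX unfolding atts_def adj_closed_def by blast
    qed
    then show ?thesis using YX by auto
  qed
  have "X = V \<union> W" if X: "X \<subseteq> V \<union> W" "X \<noteq> {}" "adj_closed G (V \<union> W) X" for X
  proof (cases "X \<inter> V = {}")
    case True
    have "W \<subseteq> X \<and> V \<inter> X \<noteq> {}"
      using step[of X W V B A] S T ov False X True by (auto simp: Un_commute Int_commute)
    then show ?thesis using True by auto
  next
    case F: False
    have *: "V \<subseteq> X \<and> W \<inter> X \<noteq> {}" using step[of X V W A B] S T ov False X F by auto
    have "W \<subseteq> X"
      using step[of X W V B A] S T ov False X * by (auto simp: Un_commute Int_commute)
    then show ?thesis using X * by auto
  qed
  moreover have "a \<in> atts G (V \<union> W) \<or> dag G a \<in> atts G (V \<union> W)" if "a \<in> A \<union> B" for a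
    using that streeD(7)[OF S] streeD(7)[OF T] False by (auto simp: atts_def)
  moreover have "atts G (V \<union> W) = atts G V \<union> atts G W" by (auto simp: atts_def)
  ultimately show ?thesis
    using S T False by (auto simp: stree_def linked_def)
qed

section \<open>Stars, and growing a subtree one vertex at a time\<close>

definition star :: "('a, 'v) graph_data \<Rightarrow> 'v \<Rightarrow> 'a set" where
  "star G v = nb G v \<union> dag G ` nb G v"

lemma stree_star:
  assumes G: "is_graph G" and v: "v \<in> Vert G"
  shows "stree G (star G v) {v}"
proof -
  note g = is_graphD[OF G]
  have "X = {v}" if "X \<subseteq> {v}" "X \<noteq> {}" for X using that by auto
  then show ?thesis
    using g v unfolding stree_def linked_def star_def nb_def atts_def by auto
qed

lemma star_subset:
  assumes "stree G A V" "v \<in> V"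
  shows "star G v \<subseteq> A"
  using streeD(3,5)[OF assms(1)] assms(2) by (auto simp: star_def nb_def)

text \<open>If \<open>V\<close> is non-empty and differs from \<open>W\<close>, it is not closed in
  \<open>W\<close>; an edge leaving \<open>V\<close> has both arcs in \<open>A\<close>, as
  \<open>A\<close> is closed under the involution, and one of them is attached to a new vertex. If
  the smaller subtree is an edge, one of its arcs must be attached in the larger one.\<close>

lemma stree_grow:
  assumes G: "is_graph G" and S: "stree G A V" and T: "stree G B W"
    and sub: "A \<subseteq> B" "V \<subseteq> W" and neq: "A \<noteq> B \<or> V \<noteq> W"
  shows "\<exists>v\<in>W - V. \<exists>a\<in>A. a \<in> nb G v"
proof (cases "V = {}")
  case True
  then obtain a where a: "A = {a, dag G a}" using streeD(6)[OF S] by auto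
  have "W \<noteq> {}" using stree_eqI[OF G S, of B] T neq sub(1) True by auto
  then have "a \<in> atts G W \<or> dag G a \<in> atts G W" using streeD(7)[OF T] a sub by auto
  then show ?thesis using a True by (auto simp: atts_def nb_def)
next
  case False
  have "V \<noteq> W" using stree_arcs_eq[OF G S, of B] T neq False by auto
  then have "\<not> adj_closed G W V" using streeD(8)[OF T] sub False by auto
  then obtain c where c: "c \<in> Att G" "dag G c \<in> Att G" "tgt G c \<in> V"
    "tgt G (dag G c) \<in> W" "tgt G (dag G c) \<notin> V"
    by (auto simp: adj_closed_def)
  then have "dag G c \<in> A" using streeD(3,5)[OF S] by auto
  then show ?thesis using c by (auto simp: nb_def)
qed

text \<open>Induction on the number of vertices of \<open>W\<close> still missing. The arc
  \<open>a\<close> makes \<open>C\<close> overlap the star of \<open>v\<close>, so each stage is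
  again a subtree, and \<open>stree_grow\<close> provides a next vertex until arcs and vertices both
  agree with the target.\<close>

lemma stree_induct [consumes 5, case_names base step]:
  assumes G: "is_graph G" and S: "stree G A V" and T: "stree G B W" and "A \<subseteq> B" "V \<subseteq> W"
    and base: "P A V"
    and step: "\<And>C U v a. \<lbrakk>stree G C U; A \<subseteq> C; V \<subseteq> U; C \<subseteq> B; U \<subseteq> W; P C U; v \<in> W; v \<notin> U; a \<in> C;
      a \<in> nb G v\<rbrakk> \<Longrightarrow> P (C \<union> star G v) (insert v U)"
  shows "P B W"
proof -
  have "finite W" using streeD(2)[OF T] is_graphD(2)[OF G] finite_subset by auto
  have "P B W" if "stree G C U" "A \<subseteq> C" "V \<subseteq> U" "C \<subseteq> B" "U \<subseteq> W" "P C U" for C U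
    using that
  proof (induction "card (W - U)" arbitrary: C U rule: less_induct)
    case less
    show ?case
    proof (cases "C = B \<and> U = W")
      case False
      then obtain v a where v: "v \<in> W" "v \<notin> U" "a \<in> C" "a \<in> nb G v"
        using stree_grow[OF G less.prems(1) T] less.prems by blast
      have st: "star G v \<subseteq> B" using star_subset[OF T v(1)] .
      have "v \<in> Vert G" using streeD(2)[OF T] v by auto
      then have "stree G (C \<union> star G v) (insert v U)"
        using stree_Un[OF G less.prems(1) stree_star[OF G]] v by (auto simp: star_def)
      moreover have "card (W - insert v U) < card (W - U)"
        using \<open>finite W\<close> v by (intro psubset_card_mono) auto
      moreover have "P (C \<union> star G v) (insert v U)" using step v less.prems by blast
      ultimately show ?thesis using less.hyps[of "insert v U" "C \<union> star G v"] less.prems v st by blast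
    qed (use less in auto)
  qed
  then show ?thesis using assms by blast
qed

text \<open>This is where a union defined through vertices alone becomes a union of subtrees. An
  edge from \<open>V\<close> to \<open>W\<close> would have an arc in both \<open>A\<close> and
  \<open>B\<close>, so without overlap \<open>V\<close> would be closed in
  \<open>V \<union> W\<close>. If one vertex set is empty, the other subtree is already all of
  \<open>C\<close>.\<close>

lemma stree_union_unique:
  assumes G: "is_graph G" and S: "stree G A V" and T: "stree G B W" and U: "stree G C (V \<union> W)"
    and sub: "A \<subseteq> C" "B \<subseteq> C"
  shows "A \<inter> B \<noteq> {} \<or> V \<inter> W \<noteq> {}" and "C = A \<union> B"
proof -
  show ov: "A \<inter> B \<noteq> {} \<or> V \<inter> W \<noteq> {}"
  proof (cases "V = {} \<or> W = {}")
    case True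
    have "V = {} \<Longrightarrow> A \<noteq> {} \<and> B = C" "W = {} \<Longrightarrow> B \<noteq> {} \<and> A = C"
      using stree_eqI[OF G S, of C] stree_eqI[OF G T, of C] U sub stree_nonempty[OF S]
        stree_nonempty[OF T] by auto
    then show ?thesis using True sub by auto
  next
    case False
    show ?thesis
    proof (rule ccontr)
      assume n: "\<not> ?thesis"
      have "adj_closed G (V \<union> W) V"
        unfolding adj_closed_def
      proof (intro allI impI, rule ccontr)
        fix c assume c: "c \<in> Att G \<and> dag G c \<in> Att G \<and> tgt G c \<in> V \<and> tgt G (dag G c) \<in> V \<union> W"
          and "tgt G (dag G c) \<notin> V"
        then have "dag G c \<in> A" "dag G c \<in> B" using streeD(3,5)[OF S] streeD(5)[OF T] by auto
        then show False using n by auto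
      qed
      then have "V = V \<union> W" using streeD(8)[OF U, of V] False by auto
      then show False using n False by auto
    qed
  qed
  show "C = A \<union> B"
    using stree_eqI[OF G stree_Un[OF G S T ov] U] sub by auto
qed

section \<open>Trees\<close>

text \<open>As in \<open>is_cycle\<close>, a walk records the arcs along which vertices are left, so
  \<open>map (tgt G) cs @ [w]\<close> lists the vertices visited.\<close>

fun walk :: "('a, 'v) graph_data \<Rightarrow> 'v \<Rightarrow> 'a list \<Rightarrow> 'v \<Rightarrow> bool" where
  "walk G u [] w \<longleftrightarrow> u = w"
| "walk G u (c # cs) w \<longleftrightarrow>
     c \<in> Att G \<and> dag G c \<in> Att G \<and> tgt G c = u \<and> walk G (tgt G (dag G c)) cs w"

lemma walk_suffix:
  assumes "walk G u cs w" "x \<in> set (map (tgt G) cs @ [w])"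
  shows "\<exists>ds es. cs = es @ ds \<and> walk G x ds w"
  using assms
proof (induction cs arbitrary: u)
  case (Cons c cs)
  show ?case
  proof (cases "x = tgt G c")
    case True
    then have "c # cs = [] @ (c # cs) \<and> walk G x (c # cs) w" using Cons by auto
    then show ?thesis by blast
  next
    case False
    then have "walk G (tgt G (dag G c)) cs w" "x \<in> set (map (tgt G) cs @ [w])"
      using Cons.prems by auto
    then obtain ds es where "cs = es @ ds" "walk G x ds w" using Cons.IH by blast
    then have "c # cs = (c # es) @ ds \<and> walk G x ds w" by simp
    then show ?thesis by blast
  qed
qed auto

lemma walk_end:
  assumes "walk G u cs w" "d \<in> set cs"
  shows "tgt G (dag G d) \<in> set (map (tgt G) cs @ [w])"
  using assms
proof (induction cs arbitrary: u)
  case (Cons c cs)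
  then show ?case by (cases cs) auto
qed auto

lemma walk_nth:
  assumes "walk G u cs w" "i < length cs"
  shows "tgt G (dag G (cs ! i)) = (map (tgt G) cs @ [w]) ! Suc i"
  using assms
proof (induction cs arbitrary: u i)
  case (Cons c cs)
  then show ?case by (cases i; cases cs) auto
qed auto

text \<open>Using an edge a second time means either leaving its start again by the same arc or
  returning to that start along the mate; both repeat a vertex.\<close>

lemma simple_walk_distinct_edges:
  assumes G: "is_graph G" and "walk G u cs w" "distinct (map (tgt G) cs @ [w])"
  shows "distinct (map (edge_of G) cs)"
  using assms(2,3)
proof (induction cs arbitrary: u)
  case (Cons c cs)
  note g = is_graphD[OF G]
  have "edge_of G d \<noteq> edge_of G c" if d: "d \<in> set cs" for d
  proof
    assume "edge_of G d = edge_of G c"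
    then have "d = c \<or> d = dag G c" by (auto simp: edge_of_def)
    moreover have "d \<noteq> c" using d Cons.prems by auto
    moreover have "dag G (dag G c) = c" using g Cons.prems by auto
    ultimately have "dag G d = c" by auto
    then have "tgt G c \<in> set (map (tgt G) cs @ [w])" using walk_end[of G _ cs w d] Cons.prems d by auto
    then show False using Cons.prems by auto
  qed
  then have "edge_of G c \<notin> edge_of G ` set cs" by (metis imageE)
  then show ?case using Cons by auto
qed auto

text \<open>
  \<^term>\<open>X\<close> consists of the vertices still joined to \<^term>\<open>tgt G a\<close> after the edge of
  \<^term>\<open>a\<close> is removed.
\<close>

lemma tree_bridge:
  assumes T: "is_tree G" and a: "a \<in> Att G" "dag G a \<in> Att G"
  obtains X where "tgt G a \<in> X" "tgt G (dag G a) \<notin> X"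
    "\<And>c. c \<in> Att G \<Longrightarrow> dag G c \<in> Att G \<Longrightarrow> c \<noteq> a \<Longrightarrow> c \<noteq> dag G a \<Longrightarrow>
      tgt G c \<in> X \<longleftrightarrow> tgt G (dag G c) \<in> X"
proof -
  have G: "is_graph G" using T by (simp add: is_tree_def connected_graph_def)
  note g = is_graphD[OF G]
  define E where "E = {(tgt G c, tgt G (dag G c)) | c.
    c \<in> Att G \<and> dag G c \<in> Att G \<and> c \<noteq> a \<and> c \<noteq> dag G a}"
  define X where "X = {u. (u, tgt G a) \<in> E\<^sup>*}"
  \<comment> \<open>Walks are kept simple by discarding the initial part whenever the newly
    prepended vertex already occurs.\<close>
  have simple: "\<exists>cs. walk G u cs w \<and> distinct (map (tgt G) cs @ [w]) \<and> (\<forall>c\<in>set cs. c \<noteq> a \<and> c \<noteq> dag G a)"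
    if "(u, w) \<in> E\<^sup>*" for u w
    using that
  proof (induction rule: converse_rtrancl_induct)
    case base
    have "walk G w [] w" by simp
    then show ?case by (metis append_Nil distinct_singleton list.map(1) list.set(1) empty_iff)
  next
    case (step u u')
    obtain c where c: "c \<in> Att G" "dag G c \<in> Att G" "c \<noteq> a" "c \<noteq> dag G a"
      "u = tgt G c" "u' = tgt G (dag G c)" using step by (auto simp: E_def)
    obtain cs where cs: "walk G u' cs w" "distinct (map (tgt G) cs @ [w])"
      "\<forall>c\<in>set cs. c \<noteq> a \<and> c \<noteq> dag G a" using step by auto
    show ?case
    proof (cases "u \<in> set (map (tgt G) cs @ [w])")
      case True
      then obtain ds es where "cs = es @ ds" "walk G u ds w" using walk_suffix[OF cs(1)] by blast
      then show ?thesis using cs by auto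
    next
      case False
      then have "walk G u (c # cs) w \<and> distinct (map (tgt G) (c # cs) @ [w])"
        using c cs by auto
      then show ?thesis using c cs by (metis set_ConsD)
    qed
  qed
  have notin: "tgt G (dag G a) \<notin> X"
  proof
    assume "tgt G (dag G a) \<in> X"
    then obtain cs where cs: "walk G (tgt G (dag G a)) cs (tgt G a)"
      "distinct (map (tgt G) cs @ [tgt G a])" "\<forall>c\<in>set cs. c \<noteq> a \<and> c \<noteq> dag G a"
      using simple unfolding X_def by blast
    have w: "walk G (tgt G a) (a # cs) (tgt G a)" using cs a by auto
    have all: "walk G u bs w \<Longrightarrow> \<forall>c\<in>set bs. c \<in> Att G \<and> dag G c \<in> Att G" for u w bs
      by (induction bs arbitrary: u) auto
    have ne: "edge_of G c \<noteq> edge_of G a" if "c \<in> set cs" for c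
      using cs(3) that by (auto simp: edge_of_def)
    \<comment> \<open>A simple walk from one end of the removed edge to the other is closed up by
      \<open>a\<close>; for \<open>cs = []\<close> this is a loop.\<close>
    have "is_cycle G (a # cs)"
      unfolding is_cycle_def
    proof (intro conjI allI impI)
      show "distinct (map (edge_of G) (a # cs))"
        using simple_walk_distinct_edges[OF G cs(1,2)] ne by force
      fix i assume i: "i < length (a # cs)"
      \<comment> \<open>For \<open>i = length cs\<close> the successor index wraps around to 0, and
        the walk has indeed returned to the target of \<open>a\<close>.\<close>
      show "tgt G (dag G ((a # cs) ! i)) = tgt G ((a # cs) ! (Suc i mod length (a # cs)))"
        using walk_nth[OF w i] i by (cases "i = length cs") (auto simp: nth_append)
    qed (use all[OF w] cs in auto)
    then show False using T by (auto simp: is_tree_def)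
  qed
  have "tgt G a \<in> X" by (simp add: X_def)
  moreover note notin
  moreover have "tgt G c \<in> X \<longleftrightarrow> tgt G (dag G c) \<in> X"
    if "c \<in> Att G" "dag G c \<in> Att G" "c \<noteq> a" "c \<noteq> dag G a" for c
  proof -
    have dd: "dag G (dag G c) = c" "dag G (dag G a) = a" using that a g by auto
    have E1: "(tgt G c, tgt G (dag G c)) \<in> E" unfolding E_def using that by blast
    have "dag G c \<noteq> a" "dag G c \<noteq> dag G a" using that dd by metis+
    moreover have "dag G (dag G c) \<in> Att G" using that(1) dd by simp
    ultimately have "(tgt G (dag G c), tgt G (dag G (dag G c))) \<in> E"
      unfolding E_def using that(2) by blast
    then show ?thesis
      unfolding X_def using E1 dd by (auto intro: converse_rtrancl_into_rtrancl)
  qed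
  ultimately show thesis by (rule that)
qed

text \<open>Two such arcs would close a cycle through \<open>v\<close>. In terms of bridges: the
  side \<open>X\<close> of the edge of \<open>a\<close> that lies away from \<open>v\<close>
  contains all of \<open>V\<close> by connectedness, but then the edge of \<open>b\<close> leads
  from \<open>X\<close> to \<open>v\<close>. If \<open>V\<close> is empty, the edge would be a loop
  at \<open>v\<close>.\<close>

lemma stree_attach_unique:
  assumes T: "is_tree G" and S: "stree G A V" and v: "v \<notin> V"
    and ab: "a \<in> A" "b \<in> A" "a \<in> nb G v" "b \<in> nb G v"
  shows "a = b"
proof (rule ccontr)
  assume neq: "a \<noteq> b"
  have G: "is_graph G" using T by (simp add: is_tree_def connected_graph_def)
  note g = is_graphD[OF G]
  have aA: "a \<in> Arc G" "a \<in> Att G" "b \<in> Att G" "tgt G a = v" "tgt G b = v"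
    using ab streeD(1)[OF S] by (auto simp: nb_def)
  have dd: "dag G (dag G a) = a" using aA g by auto
  show False
  proof (cases "V = {}")
    case True
    then have b: "b = dag G a" using stree_edge_eq[OF G S ab(1)] ab neq by auto
    have "dag G a \<in> Att G" using aA b by auto
    then obtain X where "tgt G a \<in> X" "tgt G (dag G a) \<notin> X"
      using tree_bridge[OF T aA(2)] by blast
    then show False using aA b by simp
  next
    case False
    have "a \<notin> atts G V" "b \<notin> atts G V" using aA v by (simp_all add: atts_def)
    then have att: "dag G a \<in> atts G V" "dag G b \<in> atts G V"
      using streeD(7)[OF S False ab(1)] streeD(7)[OF S False ab(2)] by simp_all
    have dAtt: "dag G a \<in> Att G" "dag G (dag G a) \<in> Att G"
      using att aA dd by (simp_all add: atts_def)
    obtain X where X: "tgt G (dag G a) \<in> X" "tgt G a \<notin> X"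
      "\<And>c. c \<in> Att G \<Longrightarrow> dag G c \<in> Att G \<Longrightarrow> c \<noteq> dag G a \<Longrightarrow> c \<noteq> a \<Longrightarrow>
        tgt G c \<in> X \<longleftrightarrow> tgt G (dag G c) \<in> X"
      using tree_bridge[OF T dAtt, unfolded dd] by blast
    have "adj_closed G V (X \<inter> V)"
      unfolding adj_closed_def
    proof (intro allI impI)
      fix c assume c: "c \<in> Att G \<and> dag G c \<in> Att G \<and> tgt G c \<in> X \<inter> V \<and> tgt G (dag G c) \<in> V"
      then have "c \<noteq> a" "c \<noteq> dag G a" using v aA dd by auto
      then show "tgt G (dag G c) \<in> X \<inter> V" using X(3) c by auto
    qed
    then have "X \<inter> V = V" using streeD(8)[OF S, of "X \<inter> V"] X(1) att by (auto simp: atts_def)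
    then have "tgt G (dag G b) \<in> X" using att(2) by (auto simp: atts_def)
    moreover have "b \<noteq> dag G a" using att(1) v aA(5) by (auto simp: atts_def)
    moreover have "dag G b \<in> Att G" using att(2) by (simp add: atts_def)
    ultimately show False using X(2) X(3)[of b] aA neq by simp
  qed
qed

lemma stree_Int_star:
  assumes T: "is_tree G" and S: "stree G A V" and v: "v \<in> Vert G" "v \<notin> V"
    and a: "a \<in> A" "a \<in> nb G v"
  shows "A \<inter> star G v = {a, dag G a}"
proof -
  have G: "is_graph G" using T by (simp add: is_tree_def connected_graph_def)
  have uniq: "b = a" if "b \<in> A" "b \<in> nb G v" for b
    using stree_attach_unique[OF T S v(2)] that a by auto
  have "b = a" if "b \<in> nb G v" "dag G b \<in> A" for b
    using uniq[of b] streeD(3)[OF S that(2)] is_graphD[OF G] that(1) by (auto simp: nb_def)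
  moreover have "dag G a \<in> A" using streeD(3)[OF S a(1)] .
  ultimately show ?thesis using a uniq unfolding star_def by blast
qed

lemma stree_meets_nb:
  assumes G: "is_graph G" and S: "stree G A V" and "A \<inter> star G v \<noteq> {}"
  shows "\<exists>a\<in>A. a \<in> nb G v"
proof -
  have "c \<in> A" if "c \<in> nb G v" "dag G c \<in> A" for c
    using streeD(3)[OF S that(2)] is_graphD[OF G] that(1) by (auto simp: nb_def)
  then show ?thesis using assms(3) by (auto simp: star_def)
qed

text \<open>The first subtree is grown from one star. Adding the star of a vertex in
  \<open>W\<close> enlarges the intersection by a subtree that overlaps it; adding any other star,
  once there is an overlap, leaves the intersection unchanged.\<close>

lemma stree_Int:
  assumes T: "is_tree G" and S: "stree G A V" and S': "stree G B W"
    and ov: "A \<inter> B \<noteq> {} \<or> V \<inter> W \<noteq> {}"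
  shows "stree G (A \<inter> B) (V \<inter> W)"
proof -
  have G: "is_graph G" using T by (simp add: is_tree_def connected_graph_def)
  note g = is_graphD[OF G]
  have star: "stree G (star G v \<inter> B) ({v} \<inter> W)"
    if v: "v \<in> Vert G" and ov: "star G v \<inter> B \<noteq> {} \<or> {v} \<inter> W \<noteq> {}" for v
  proof (cases "v \<in> W")
    case True
    then show ?thesis using star_subset[OF S' True] stree_star[OF G v] by (simp add: Int_absorb2)
  next
    case False
    then obtain a where a: "a \<in> B" "a \<in> nb G v" using stree_meets_nb[OF G S', of v] ov by auto
    then have "a \<in> Arc G" using streeD(1)[OF S'] by auto
    then show ?thesis
      using stree_Int_star[OF T S' v False a] stree_edge[OF G] False by (auto simp: Int_commute)
  qed
  \<comment> \<open>The premise is needed since a partial stage \<open>C\<close> need not meet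
    \<open>B\<close> yet.\<close>
  define P where "P C U \<longleftrightarrow> (C \<inter> B \<noteq> {} \<or> U \<inter> W \<noteq> {} \<longrightarrow> stree G (C \<inter> B) (U \<inter> W))" for C U
  show ?thesis
  proof (cases "V = {}")
    case True
    then obtain a where a: "a \<in> A" "a \<in> B" using ov by auto
    then have "A \<subseteq> B" using stree_edge_eq[OF G S a(1) True] streeD(3)[OF S' a(2)] by auto
    then show ?thesis using True S by (simp add: Int_absorb2)
  next
    case False
    then obtain v0 where v0: "v0 \<in> V" by auto
    then have v0G: "v0 \<in> Vert G" using streeD(2)[OF S] by auto
    have s0: "stree G (star G v0) {v0}" using stree_star[OF G v0G] .
    have sub0: "star G v0 \<subseteq> A" "{v0} \<subseteq> V" using star_subset[OF S v0] v0 by auto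
    have "P A V"
    proof (rule stree_induct[OF G s0 S sub0])
      show "P (star G v0) {v0}" using star[OF v0G] by (simp add: P_def)
    next
      fix C U v a
      assume C: "stree G C U" "P C U" and v: "v \<in> V" "v \<notin> U" "a \<in> C" "a \<in> nb G v"
      have vG: "v \<in> Vert G" using streeD(2)[OF S] v by auto
      show "P (C \<union> star G v) (insert v U)"
        unfolding P_def
      proof
        assume ov: "(C \<union> star G v) \<inter> B \<noteq> {} \<or> insert v U \<inter> W \<noteq> {}"
        show "stree G ((C \<union> star G v) \<inter> B) (insert v U \<inter> W)"
        proof (cases "C \<inter> B \<noteq> {} \<or> U \<inter> W \<noteq> {}")
          case True
          then have CB: "stree G (C \<inter> B) (U \<inter> W)" using C by (simp add: P_def)
          show ?thesis
          proof (cases "v \<in> W")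
            case True
            have sB: "star G v \<subseteq> B" using star_subset[OF S' True] .
            have "a \<in> star G v" using v by (simp add: star_def)
            then have "stree G ((C \<inter> B) \<union> star G v) ((U \<inter> W) \<union> {v})"
              using stree_Un[OF G CB stree_star[OF G vG]] v sB by auto
            moreover have "(C \<inter> B) \<union> star G v = (C \<union> star G v) \<inter> B" "(U \<inter> W) \<union> {v} = insert v U \<inter> W"
              using sB True by auto
            ultimately show ?thesis by simp
          next
            case F: False
            \<comment> \<open>Uniqueness of attachment is applied to the union: the star of
              \<open>v\<close> meets both \<open>C\<close> and \<open>B\<close> only in the edge of
              \<open>a\<close>, which already belongs to \<open>C\<close>.\<close>
            have u: "stree G (C \<union> B) (U \<union> W)" using stree_Un[OF G C(1) S' True] .
            have "(C \<union> B) \<inter> star G v = {a, dag G a}"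
              using stree_Int_star[OF T u vG, of a] v F by auto
            moreover have "dag G a \<in> C" using streeD(3)[OF C(1) v(3)] .
            ultimately have "(C \<union> star G v) \<inter> B = C \<inter> B" using v(3) by blast
            moreover have "insert v U \<inter> W = U \<inter> W" using F by auto
            ultimately show ?thesis using CB by simp
          qed
        next
          case False
          then have "(C \<union> star G v) \<inter> B = star G v \<inter> B" "insert v U \<inter> W = {v} \<inter> W" by auto
          then show ?thesis using star[OF vG] ov by simp
        qed
      qed
    qed
    then show ?thesis using ov by (simp add: P_def)
  qed
qed

section \<open>Embeddings into trees\<close>

definition img :: "('a, 'v) graph_data \<Rightarrow> ('a, 'v, 'b, 'w) gmap \<Rightarrow> ('b, 'w) sub" where
  "img H f = (fst f ` Arc H, fst f ` Att H, snd f ` Vert H)"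

lemma tree_is_graph: "is_tree G \<Longrightarrow> is_graph G"
  by (simp add: is_tree_def connected_graph_def)

lemma etaleD:
  assumes "etale H G f"
  shows "is_graph H" "is_graph G"
    "a \<in> Arc H \<Longrightarrow> fst f a \<in> Arc G" "a \<in> Arc H \<Longrightarrow> fst f (dag H a) = dag G (fst f a)"
    "d \<in> Att H \<Longrightarrow> fst f d \<in> Att G" "v \<in> Vert H \<Longrightarrow> snd f v \<in> Vert G"
    "d \<in> Att H \<Longrightarrow> tgt G (fst f d) = snd f (tgt H d)"
    "v \<in> Vert H \<Longrightarrow> bij_betw (fst f) (nb H v) (nb G (snd f v))"
  using assms unfolding etale_def involutive_on_def by auto

text \<open>The target of an attached arc is recovered by injectivity on vertices, and the arc
  itself by bijectivity on the neighbourhood of that target.\<close>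

lemma embedding_inj_on_Att:
  assumes e: "embedding H G f" and de: "d \<in> Att H" "e \<in> Att H" "fst f d = fst f e"
  shows "d = e"
proof -
  have et: "etale H G f" and inj: "inj_on (snd f) (Vert H)" using e by (auto simp: embedding_def)
  note E = etaleD[OF et]
  note h = is_graphD[OF E(1)]
  have "snd f (tgt H d) = snd f (tgt H e)" using E(7) de by metis
  then have "tgt H d = tgt H e" using inj h(7) de by (meson inj_onD)
  moreover have "inj_on (fst f) (nb H (tgt H e))"
    using E(8) h(7) de by (meson bij_betw_imp_inj_on)
  ultimately show ?thesis using de by (auto simp: nb_def inj_on_def)
qed

text \<open>
  If two arcs were identified, an internal edge of \<^term>\<open>G\<close> would be the image of two boundary
  edges of \<^term>\<open>H\<close>; as that edge is a bridge of \<^term>\<open>G\<close>, \<^term>\<open>H\<close> could not be connected.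
\<close>

lemma embedding_inj_on_Arc:
  assumes T: "is_tree G" and e: "embedding H G f"
  shows "inj_on (fst f) (Arc H)"
proof (rule inj_onI, rule ccontr)
  have et: "etale H G f" and con: "connected_graph H" using e by (auto simp: embedding_def)
  note E = etaleD[OF et]
  note h = is_graphD[OF E(1)] and g = is_graphD[OF E(2)]
  note L = connected_graph_imp_linked[OF con]
  have SH: "stree H (Arc H) (Vert H)" using stree_whole[OF con] .
  have no: False if a: "a \<in> Arc H" "b \<in> Arc H" "fst f a = fst f b" "a \<noteq> b" "a \<notin> Att H" for a b
  proof -
    have "Vert H \<noteq> {}"
    proof
      assume "Vert H = {}"
      then have "b = dag H a" using stree_edge_eq[OF E(1) SH a(1)] a by auto
      then show False using E(3,4) g(5) a by metis
    qed
    then have edge: "c \<in> Att H \<or> dag H c \<in> Att H" if "c \<in> Arc H" for c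
      using streeD(7)[OF SH _ that] atts_Vert[OF E(1)] by simp
    have da: "dag H a \<in> Att H" using edge a by auto
    have fd: "fst f (dag H a) = fst f (dag H b)" using E(4) a by simp
    have "dag H b \<notin> Att H"
    proof
      assume "dag H b \<in> Att H"
      then have "dag H a = dag H b" using embedding_inj_on_Att[OF e da] fd by blast
      then show False using h(6) a by metis
    qed
    then have b: "b \<in> Att H" using edge a by auto
    have fb: "fst f b \<in> Att G" "dag G (fst f b) \<in> Att G"
      using E(5)[OF b] E(5)[OF da] E(4)[OF a(1)] a(3) by simp_all
    obtain X where X: "tgt G (fst f b) \<in> X" "tgt G (dag G (fst f b)) \<notin> X"
      "\<And>c. c \<in> Att G \<Longrightarrow> dag G c \<in> Att G \<Longrightarrow> c \<noteq> fst f b \<Longrightarrow> c \<noteq> dag G (fst f b) \<Longrightarrow>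
        tgt G c \<in> X \<longleftrightarrow> tgt G (dag G c) \<in> X"
      using tree_bridge[OF T fb] by blast
    \<comment> \<open>No internal edge of \<open>H\<close> lies over the bridge: the only attached
      arc over \<open>fst f b\<close> is \<open>b\<close>, whose mate is not attached. So
      \<open>Y\<close> is closed under adjacency, although it contains the target of
      \<open>b\<close> and not that of \<open>dag H a\<close>.\<close>
    define Y where "Y = {v \<in> Vert H. snd f v \<in> X}"
    have "adj_closed H (Vert H) Y"
      unfolding adj_closed_def
    proof (intro allI impI)
      fix c assume c: "c \<in> Att H \<and> dag H c \<in> Att H \<and> tgt H c \<in> Y \<and> tgt H (dag H c) \<in> Vert H"
      have cA: "c \<in> Arc H" using c h(3) by auto
      have fc: "fst f c \<in> Att G" "dag G (fst f c) \<in> Att G" "fst f (dag H c) = dag G (fst f c)"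
        using c E(4)[OF cA] E(5)[of c] E(5)[of "dag H c"] by simp_all
      have tc: "tgt G (fst f c) \<in> X" using c E(7)[of c] by (simp add: Y_def)
      have "fst f c \<noteq> fst f b"
        using embedding_inj_on_Att[OF e _ b, of c] c \<open>dag H b \<notin> Att H\<close> by blast
      moreover have "fst f c \<noteq> dag G (fst f b)" using tc X(2) by auto
      ultimately have "tgt G (dag G (fst f c)) \<in> X" using X(3) fc tc by blast
      then show "tgt H (dag H c) \<in> Y" using c fc(3) E(7)[of "dag H c"] by (simp add: Y_def)
    qed
    moreover have "tgt H b \<in> Y" using X(1) E(7)[OF b] h(7)[OF b] by (simp add: Y_def)
    ultimately have "Y = Vert H" using streeD(8)[OF SH, of Y] by (auto simp: Y_def)
    then have "snd f (tgt H (dag H a)) \<in> X" using h(7)[OF da] by (auto simp: Y_def)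
    moreover have "snd f (tgt H (dag H a)) = tgt G (dag G (fst f b))"
      using E(7)[OF da] E(4)[OF a(1)] a(3) by simp
    ultimately show False using X(2) by simp
  qed
  fix a b assume ab: "a \<in> Arc H" "b \<in> Arc H" "fst f a = fst f b" "a \<noteq> b"
  show False
    using no[of a b] no[of b a] embedding_inj_on_Att[OF e, of a b] ab by metis
qed

text \<open>Bijectivity on neighbourhoods makes the image of \<open>Att H\<close> all arcs attached
  to image vertices. Connectedness passes to the image because closed sets of image vertices pull
  back to closed sets of \<open>H\<close>.\<close>

lemma img_subtree:
  assumes T: "is_tree G" and e: "embedding H G f"
  shows "img H f \<in> subtrees G"
proof -
  have et: "etale H G f" and con: "connected_graph H" using e by (auto simp: embedding_def)
  note E = etaleD[OF et]
  note h = is_graphD[OF E(1)] and g = is_graphD[OF E(2)]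
  have SH: "stree H (Arc H) (Vert H)" using stree_whole[OF con] .
  let ?A = "fst f ` Arc H" and ?V = "snd f ` Vert H"
  have att: "fst f ` Att H = atts G ?V"
  proof
    show "fst f ` Att H \<subseteq> atts G ?V" using E(5,7) h(7) by (auto simp: atts_def)
    show "atts G ?V \<subseteq> fst f ` Att H"
    proof
      fix d assume "d \<in> atts G ?V"
      then obtain v where v: "v \<in> Vert H" "d \<in> nb G (snd f v)" by (auto simp: atts_def nb_def)
      then have "d \<in> fst f ` nb H v" using E(8) by (metis bij_betw_imp_surj_on)
      then show "d \<in> fst f ` Att H" by (auto simp: nb_def)
    qed
  qed
  have "linked G ?A ?V"
  proof (cases "Vert H = {}")
    case True
    then obtain a where "Arc H = {a, dag H a}" using streeD(6)[OF SH] by auto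
    then have "?A = {fst f a, dag G (fst f a)}" using E(4)[of a] by auto
    then show ?thesis using True by (auto simp: linked_def)
  next
    case False
    have "X = ?V" if X: "X \<subseteq> ?V" "X \<noteq> {}" "adj_closed G ?V X" for X
    proof -
      define Y where "Y = {v \<in> Vert H. snd f v \<in> X}"
      have "adj_closed H (Vert H) Y"
        unfolding adj_closed_def
      proof (intro allI impI)
        fix c assume c: "c \<in> Att H \<and> dag H c \<in> Att H \<and> tgt H c \<in> Y \<and> tgt H (dag H c) \<in> Vert H"
        have cA: "c \<in> Arc H" using c h(3) by auto
        have "fst f c \<in> Att G" "dag G (fst f c) \<in> Att G" "tgt G (fst f c) \<in> X"
          "tgt G (dag G (fst f c)) = snd f (tgt H (dag H c))"
          using c E(4)[OF cA] E(5)[of c] E(5)[of "dag H c"] E(7)[of c] E(7)[of "dag H c"]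
          by (simp_all add: Y_def)
        then show "tgt H (dag H c) \<in> Y" using X(3) c by (auto simp: Y_def adj_closed_def)
      qed
      moreover have "Y \<noteq> {}" using X(1,2) by (auto simp: Y_def)
      ultimately have "Y = Vert H" using streeD(8)[OF SH, of Y] by (auto simp: Y_def)
      then show ?thesis using X(1) by (auto simp: Y_def)
    qed
    moreover have "a \<in> atts G ?V \<or> dag G a \<in> atts G ?V" if "a \<in> ?A" for a
    proof -
      obtain b where b: "b \<in> Arc H" "a = fst f b" using \<open>a \<in> ?A\<close> by auto
      then have "b \<in> Att H \<or> dag H b \<in> Att H"
        using streeD(7)[OF SH False] atts_Vert[OF E(1)] by simp
      then show ?thesis using b E(4)[of b] unfolding att[symmetric] by (metis imageI)
    qed
    ultimately show ?thesis using False by (auto simp: linked_def)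
  qed
  moreover have "dag G a \<in> ?A" if "a \<in> ?A" for a
    using that E(4) h(4) by (metis (no_types, lifting) image_iff)
  ultimately have "stree G ?A ?V"
    using E(3,6) h(3) att[symmetric] unfolding stree_def by auto
  then show ?thesis using att subtrees_iff[OF E(2)] by (simp add: img_def)
qed

text \<open>As \<open>k\<close> is injective on arcs and vertices, \<open>j\<close> can only be
  \<open>h\<close> followed by the inverse of \<open>k\<close>. It is bijective on neighbourhoods
  because \<open>h\<close> and \<open>k\<close> are, and surjective if the images agree.\<close>

lemma embedding_factor:
  assumes T: "is_tree G" and eh: "embedding H G h" and ek: "embedding K G k"
    and sub: "fst h ` Arc H \<subseteq> fst k ` Arc K" "snd h ` Vert H \<subseteq> snd k ` Vert K"
  shows "\<exists>j. embedding H K j \<and> gmap_eq H h (gmap_comp k j) \<and>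
    (img H h = img K k \<longrightarrow> graph_iso H K j)"
proof -
  have eth: "etale H G h" and injh: "inj_on (snd h) (Vert H)"
    and etk: "etale K G k" and injk: "inj_on (snd k) (Vert K)"
    using eh ek by (auto simp: embedding_def)
  note E = etaleD[OF eth] and F = etaleD[OF etk]
  note gh = is_graphD[OF E(1)] and gk = is_graphD[OF F(1)]
  have ih: "inj_on (fst h) (Arc H)" and ik: "inj_on (fst k) (Arc K)"
    using embedding_inj_on_Arc[OF T eh] embedding_inj_on_Arc[OF T ek] by auto
  define p where "p = (\<lambda>a. the_inv_into (Arc K) (fst k) (fst h a))"
  define q where "q = (\<lambda>v. the_inv_into (Vert K) (snd k) (snd h v))"
  have p: "p a \<in> Arc K" "fst k (p a) = fst h a" if "a \<in> Arc H" for a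
    unfolding p_def using that sub(1) the_inv_into_into[OF ik, of "fst h a" "Arc K"]
      f_the_inv_into_f[OF ik, of "fst h a"] by auto
  have q: "q v \<in> Vert K" "snd k (q v) = snd h v" if "v \<in> Vert H" for v
    unfolding q_def using that sub(2) the_inv_into_into[OF injk, of "snd h v" "Vert K"]
      f_the_inv_into_f[OF injk, of "snd h v"] by auto
  have pI: "p a = b" if "a \<in> Arc H" "b \<in> Arc K" "fst k b = fst h a" for a b
    using p[OF that(1)] that ik by (metis inj_onD)
  have qI: "q v = w" if "v \<in> Vert H" "w \<in> Vert K" "snd k w = snd h v" for v w
    using q[OF that(1)] that injk by (metis inj_onD)
  have nbK: "p d \<in> nb K (q v)" if d: "d \<in> nb H v" and v: "v \<in> Vert H" for d v
  proof -
    have "d \<in> Arc H" using d gh(3) by (auto simp: nb_def)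
    have "fst h d \<in> nb G (snd k (q v))"
      using E(8)[OF v] d q[OF v] bij_betwE by metis
    then have "fst h d \<in> fst k ` nb K (q v)"
      using F(8)[OF q(1)[OF v]] by (metis bij_betw_imp_surj_on)
    then obtain e where e: "e \<in> nb K (q v)" "fst k e = fst h d" by auto
    then have "p d = e" using pI[OF \<open>d \<in> Arc H\<close>, of e] gk(3) by (auto simp: nb_def)
    then show ?thesis using e by simp
  qed
  have pinj: "inj_on p (Arc H)"
    using p(2) ih by (metis (no_types, lifting) inj_on_def)
  have qinj: "inj_on q (Vert H)"
    using q(2) injh by (metis (no_types, lifting) inj_on_def)
  have patt: "p d \<in> Att K" "tgt K (p d) = q (tgt H d)" if "d \<in> Att H" for d
    using nbK[of d "tgt H d"] that gh(7) by (auto simp: nb_def)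
  have "bij_betw p (nb H v) (nb K (q v))" if v: "v \<in> Vert H" for v
    unfolding bij_betw_def
  proof
    show "inj_on p (nb H v)"
      using pinj by (rule inj_on_subset) (use gh(3) in \<open>auto simp: nb_def\<close>)
    have "e \<in> p ` nb H v" if e: "e \<in> nb K (q v)" for e
    proof -
      have "fst k e \<in> nb G (snd h v)"
        using F(8)[OF q(1)[OF v]] e q[OF v] bij_betwE by metis
      then have "fst k e \<in> fst h ` nb H v" using E(8)[OF v] by (metis bij_betw_imp_surj_on)
      then obtain d where d: "d \<in> nb H v" "fst k e = fst h d" by auto
      then have "p d = e" using pI[of d e] gh(3) gk(3) e by (auto simp: nb_def)
      then show ?thesis using d by auto
    qed
    then show "p ` nb H v = nb K (q v)" using nbK[OF _ v] by blast
  qed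
  moreover have "p (dag H a) = dag K (p a)" if a: "a \<in> Arc H" for a
  proof (rule pI)
    show "dag H a \<in> Arc H" "dag K (p a) \<in> Arc K" using gh(4) gk(4) p a by auto
    show "fst k (dag K (p a)) = fst h (dag H a)" using E(4)[OF a] F(4) p[OF a] by simp
  qed
  ultimately have et: "etale H K (p, q)"
    using E(1) F(1) p(1) q(1) patt unfolding etale_def involutive_on_def by auto
  have emb: "embedding H K (p, q)"
    using et qinj eh ek by (simp add: embedding_def)
  have "graph_iso H K (p, q)" if "img H h = img K k"
  proof -
    have im: "fst h ` Arc H = fst k ` Arc K" "fst h ` Att H = fst k ` Att K"
      "snd h ` Vert H = snd k ` Vert K"
      using that by (simp_all add: img_def)
    have "b \<in> p ` Arc H" if b: "b \<in> Arc K" for b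
    proof -
      obtain a where "a \<in> Arc H" "fst h a = fst k b" using im(1) b by (metis imageE imageI)
      then show ?thesis using pI[of a b] b by auto
    qed
    moreover have "b \<in> p ` Att H" if b: "b \<in> Att K" for b
    proof -
      obtain a where "a \<in> Att H" "fst h a = fst k b" using im(2) b by (metis imageE imageI)
      then show ?thesis using pI[of a b] b gh(3) gk(3) by auto
    qed
    moreover have "w \<in> q ` Vert H" if w: "w \<in> Vert K" for w
    proof -
      obtain v where "v \<in> Vert H" "snd h v = snd k w" using im(3) w by (metis imageE imageI)
      then show ?thesis using qI[of v w] w by auto
    qed
    ultimately have "p ` Arc H = Arc K" "p ` Att H = Att K" "q ` Vert H = Vert K"
      using p(1) q(1) patt(1) by blast+
    moreover have "inj_on p (Att H)" using pinj gh(3) by (rule inj_on_subset)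
    ultimately show ?thesis
      using et pinj qinj by (simp add: graph_iso_def bij_betw_def)
  qed
  moreover have "gmap_eq H h (gmap_comp k (p, q))"
    using p(2) q(2) by (simp add: gmap_eq_def gmap_comp_def)
  ultimately show ?thesis using emb by blast
qed

text \<open>Precomposing with an isomorphism does not change the image, and by
  \<open>embedding_factor\<close> equal images differ by an isomorphism.\<close>

lemma emb_class_eq:
  assumes T: "is_tree G" and f: "embedding H G f"
  shows "emb_class G H f = {(K, k). embedding K G k \<and> img K k = img H f}"
proof -
  have "img K k = img H f" if z: "graph_iso K H z" "gmap_eq K k (gmap_comp f z)"
    for K :: "(nat, nat) graph_data" and k z
  proof -
    have "is_graph K" using z(1) by (simp add: graph_iso_def etale_def)
    then have "Att K \<subseteq> Arc K" by (rule is_graphD)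
    then have "fst k ` Arc K = fst f ` (fst z ` Arc K)" "fst k ` Att K = fst f ` (fst z ` Att K)"
      "snd k ` Vert K = snd f ` (snd z ` Vert K)"
      using z(2) unfolding gmap_eq_def gmap_comp_def image_image
      by (auto intro!: image_cong)
    then show ?thesis using z(1) by (simp add: img_def graph_iso_def bij_betw_def)
  qed
  moreover have "\<exists>z. graph_iso K H z \<and> gmap_eq K k (gmap_comp f z)"
    if "embedding K G k" "img K k = img H f" for K :: "(nat, nat) graph_data" and k
    using embedding_factor[OF T that(1) f] that(2) by (auto simp: img_def)
  ultimately show ?thesis unfolding emb_class_def by blast
qed

lemma sub_graph_embedding:
  assumes T: "is_tree G" and S: "S \<in> subtrees G"
  shows "embedding (sub_graph G S) G (id, id)" and "img (sub_graph G S) (id, id) = S"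
proof -
  obtain A D V where S': "S = (A, D, V)" by (cases S) auto
  have con: "connected_graph (sub_graph G (A, D, V))"
    and sub: "A \<subseteq> Arc G" "V \<subseteq> Vert G" "D = {d \<in> Att G. tgt G d \<in> V}"
    using S unfolding S' subtrees_def by auto
  have "is_graph (sub_graph G (A, D, V))" using con by (simp add: connected_graph_def)
  moreover have "nb (sub_graph G (A, D, V)) v = nb G v" if "v \<in> V" for v
    using that sub by (auto simp: nb_def)
  ultimately show "embedding (sub_graph G S) G (id, id)"
    using T con sub tree_is_graph[OF T] unfolding S' embedding_def etale_def involutive_on_def
    by (auto simp: is_tree_def)
  show "img (sub_graph G S) (id, id) = S" by (simp add: S' img_def)
qed

lemma sub_emb_eq:
  assumes "is_tree G" and "S \<in> subtrees G"
  shows "sub_emb G S = {(K, k). embedding K G k \<and> img K k = S}"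
  unfolding sub_emb_def
  using emb_class_eq[OF assms(1) sub_graph_embedding(1)[OF assms]] sub_graph_embedding(2)[OF assms]
  by simp

text \<open>Classes contain only embeddings whose domains are built on natural numbers. The subtree
  is therefore relabelled along injections of its finite sets into the naturals, and the embedding
  is the inverse relabelling; this guarantees that classes are non-empty.\<close>

lemma subtree_nat_embedding:
  assumes T: "is_tree G" and S: "S \<in> subtrees G"
  shows "\<exists>(K :: (nat, nat) graph_data) k. embedding K G k \<and> img K k = S"
proof -
  let ?H = "sub_graph G S"
  note e = sub_graph_embedding[OF T S]
  have con: "connected_graph ?H" using e(1) by (simp add: embedding_def)
  have H: "is_graph ?H" using con by (simp add: connected_graph_def)
  note h = is_graphD[OF H]
  have SH: "stree ?H (Arc ?H) (Vert ?H)" using stree_whole[OF con] .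
  obtain p :: "'a \<Rightarrow> nat" where p: "inj_on p (Arc ?H)"
    using finite_imp_inj_to_nat_seg[OF h(1)] by blast
  obtain q :: "'b \<Rightarrow> nat" where q: "inj_on q (Vert ?H)"
    using finite_imp_inj_to_nat_seg[OF h(2)] by blast
  define p' q' where "p' = the_inv_into (Arc ?H) p" and "q' = the_inv_into (Vert ?H) q"
  have p': "p' (p a) = a" if "a \<in> Arc ?H" for a
    unfolding p'_def using the_inv_into_f_f[OF p that] .
  have q': "q' (q v) = v" if "v \<in> Vert ?H" for v
    unfolding q'_def using the_inv_into_f_f[OF q that] .
  define K where "K = \<lparr>Arc = p ` Arc ?H, Att = p ` Att ?H, Vert = q ` Vert ?H,
    dag = p \<circ> dag ?H \<circ> p', tgt = q \<circ> tgt ?H \<circ> p'\<rparr>"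
  have K: "Arc K = p ` Arc ?H" "Att K = p ` Att ?H" "Vert K = q ` Vert ?H"
    by (simp_all add: K_def)
  have dagK: "dag K (p a) = p (dag ?H a)" and tgtK: "tgt K (p a) = q (tgt ?H a)"
    if "a \<in> Arc ?H" for a
    using p' that by (simp_all add: K_def)
  have dagA: "dag ?H a \<in> Arc ?H" "dag ?H a \<noteq> a" "dag ?H (dag ?H a) = a" if "a \<in> Arc ?H" for a
    using h that by auto
  have "p (dag ?H a) \<noteq> p a" if "a \<in> Arc ?H" for a
    using dagA[OF that] p' that by metis
  then have GK: "is_graph K"
    unfolding is_graph_def K using h dagA by (auto simp: dagK tgtK subset_iff)
  have "linked K (Arc K) (Vert K)"
  proof (cases "Vert ?H = {}")
    case True
    then obtain a where a: "Arc ?H = {a, dag ?H a}" using streeD(6)[OF SH] by auto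
    then have "Arc K = {p a, dag K (p a)}" using dagK[of a] by (simp add: K)
    then show ?thesis using True by (auto simp: linked_def K)
  next
    case False
    have "Y = Vert K" if Y: "Y \<subseteq> Vert K" "Y \<noteq> {}" "adj_closed K (Vert K) Y" for Y
    proof -
      define X where "X = {v \<in> Vert ?H. q v \<in> Y}"
      have "adj_closed ?H (Vert ?H) X"
        unfolding adj_closed_def
      proof (intro allI impI)
        fix c assume c: "c \<in> Att ?H \<and> dag ?H c \<in> Att ?H \<and> tgt ?H c \<in> X \<and>
          tgt ?H (dag ?H c) \<in> Vert ?H"
        then have cA: "c \<in> Arc ?H" "dag ?H c \<in> Arc ?H" using h(3) by auto
        have "p c \<in> Att K" "dag K (p c) \<in> Att K" "tgt K (p c) \<in> Y"
          "tgt K (dag K (p c)) = q (tgt ?H (dag ?H c))"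
          using c by (simp_all add: K dagK tgtK cA X_def)
        then show "tgt ?H (dag ?H c) \<in> X" using Y(3) c by (auto simp: adj_closed_def X_def K)
      qed
      moreover have "X \<noteq> {}" using Y(1,2) by (auto simp: X_def K)
      ultimately have "X = Vert ?H" using streeD(8)[OF SH, of X] by (auto simp: X_def)
      then show ?thesis using Y(1) by (auto simp: X_def K)
    qed
    moreover have "a \<in> Att K \<or> dag K a \<in> Att K" if a: "a \<in> Arc K" for a
    proof -
      obtain b where b: "b \<in> Arc ?H" "a = p b" using a by (auto simp: K)
      then have "b \<in> Att ?H \<or> dag ?H b \<in> Att ?H"
        using streeD(7)[OF SH False] atts_Vert[OF H] by simp
      then show ?thesis using b dagK[of b] by (auto simp: K)
    qed
    moreover have "Vert K \<noteq> {}" using False K(3) by simp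
    ultimately show ?thesis unfolding linked_def atts_Vert[OF GK] by simp
  qed
  then have conK: "connected_graph K" by (rule linked_imp_connected_graph[OF GK])
  have et: "etale ?H G (id, id)" using e(1) by (simp add: embedding_def)
  note E = etaleD[OF et, simplified]
  have "bij_betw p' (nb K (q v)) (nb G v)" if v: "v \<in> Vert ?H" for v
  proof -
    have N: "nb ?H v \<subseteq> Arc ?H" using h(3) by (auto simp: nb_def)
    have "tgt ?H d = v" if "d \<in> Att ?H" "q (tgt ?H d) = q v" for d
      using q' h(7)[OF that(1)] v that(2) by metis
    then have "nb K (q v) = p ` nb ?H v"
      using h(3) by (auto simp: nb_def K tgtK subset_iff)
    moreover have "nb G v = nb ?H v" using E(8)[OF v] by (simp add: bij_betw_def)
    moreover have "bij_betw p' (p ` nb ?H v) (nb ?H v)"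
      by (rule bij_betw_byWitness[where f' = p]) (use N p' in \<open>auto simp: subset_iff\<close>)
    ultimately show ?thesis by simp
  qed
  then have "etale K G (p', q')"
    using GK E(2,3,4,5,6,7) h(3,7) dagA(1) unfolding etale_def involutive_on_def K
    by (auto simp: dagK tgtK p' q' subset_iff)
  moreover have "inj_on q' (Vert K)" using q' by (auto simp: K inj_on_def)
  moreover have "connected_graph G" using T by (simp add: is_tree_def)
  ultimately have "embedding K G (p', q')" using conK by (simp add: embedding_def)
  moreover have "img K (p', q') = S"
  proof -
    have "p' ` p ` Arc ?H = Arc ?H" "p' ` p ` Att ?H = Att ?H" "q' ` q ` Vert ?H = Vert ?H"
      using p' q' h(3) by (force simp: image_image)+
    then show ?thesis using e(2) by (simp add: img_def K)
  qed
  ultimately show ?thesis by blast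
qed

lemma sub_emb_nonempty:
  assumes "is_tree G" and "S \<in> subtrees G"
  shows "sub_emb G S \<noteq> {}"
  using subtree_nat_embedding[OF assms] by (auto simp: sub_emb_eq[OF assms])

lemma bij_betw_sub_emb:
  assumes T: "is_tree G"
  shows "bij_betw (sub_emb G) (subtrees G) (Emb G)"
  unfolding bij_betw_def
proof
  show "inj_on (sub_emb G) (subtrees G)"
  proof (rule inj_onI)
    fix S S' assume S: "S \<in> subtrees G" "S' \<in> subtrees G" and eq: "sub_emb G S = sub_emb G S'"
    obtain K k where "(K, k) \<in> sub_emb G S" using sub_emb_nonempty[OF T S(1)] by auto
    then have "img K k = S" "img K k = S'"
      using eq by (auto simp: sub_emb_eq[OF T] S)
    then show "S = S'" by simp
  qed
  have "sub_emb G S \<in> Emb G" if S: "S \<in> subtrees G" for S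
  proof -
    obtain K :: "(nat, nat) graph_data" and k where k: "embedding K G k" "img K k = S"
      using subtree_nat_embedding[OF T S] by auto
    then have "sub_emb G S = emb_class G K k"
      by (simp add: sub_emb_eq[OF T S] emb_class_eq[OF T])
    then show ?thesis using k(1) unfolding Emb_def by blast
  qed
  moreover have "x \<in> sub_emb G ` subtrees G" if x: "x \<in> Emb G" for x
  proof -
    obtain H :: "(nat, nat) graph_data" and f where f: "x = emb_class G H f" "embedding H G f"
      using x unfolding Emb_def by auto
    have S: "img H f \<in> subtrees G" using img_subtree[OF T f(2)] .
    have "x = sub_emb G (img H f)" using f by (simp add: sub_emb_eq[OF T S] emb_class_eq[OF T])
    then show ?thesis using S by blast
  qed
  ultimately show "sub_emb G ` subtrees G = Emb G" by blast
qed

section \<open>Vertices, boundary, order and edges of a class, read off from its subtree\<close>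

lemma UN_pair_const:
  assumes "X \<noteq> {}" "\<And>x y. (x, y) \<in> X \<Longrightarrow> F x y = c"
  shows "(\<Union>(x, y)\<in>X. F x y) = c"
proof -
  have "(\<Union>(x, y)\<in>X. F x y) = (\<Union>_\<in>X. c)" by (rule SUP_cong) (auto simp: assms(2))
  then show ?thesis using assms(1) by simp
qed

lemma emb_verts_sub_emb:
  assumes "is_tree G" and "S \<in> subtrees G"
  shows "emb_verts (sub_emb G S) = sub_verts S"
  unfolding emb_verts_def
proof (rule UN_pair_const[OF sub_emb_nonempty[OF assms]])
  fix H h assume "(H, h) \<in> sub_emb G S"
  then show "snd h ` Vert H = sub_verts S" by (auto simp: sub_emb_eq[OF assms] img_def)
qed

lemma emb_bdry_sub_emb:
  assumes T: "is_tree G" and S: "S \<in> subtrees G"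
  shows "emb_bdry (sub_emb G S) = sub_arcs S - atts G (sub_verts S)"
proof -
  have SD: "fst (snd S) = atts G (sub_verts S)"
    using subtrees_iff[OF tree_is_graph[OF T], of S] S by (metis fst_conv snd_conv)
  have "fst h ` bdry H = sub_arcs S - atts G (sub_verts S)" if "(H, h) \<in> sub_emb G S" for H h
  proof -
    have h: "embedding H G h" "img H h = S" using that by (auto simp: sub_emb_eq[OF T S])
    have "Att H \<subseteq> Arc H" using h(1) by (auto simp: embedding_def etale_def is_graph_def)
    \<comment> \<open>Injectivity on arcs lets the image commute with the set difference.\<close>
    then have "fst h ` bdry H = fst h ` Arc H - fst h ` Att H"
      using inj_on_image_set_diff[OF embedding_inj_on_Arc[OF T h(1)], of "Arc H" "Att H"]
      by (auto simp: bdry_def)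
    then show ?thesis using h(2) SD by (auto simp: img_def)
  qed
  then show ?thesis
    unfolding emb_bdry_def by (rule UN_pair_const[OF sub_emb_nonempty[OF T S]])
qed

lemma emb_le_sub_emb:
  assumes T: "is_tree G" and S: "S \<in> subtrees G" and S': "S' \<in> subtrees G"
  shows "emb_le (sub_emb G S) (sub_emb G S') \<longleftrightarrow>
    sub_arcs S \<subseteq> sub_arcs S' \<and> sub_verts S \<subseteq> sub_verts S'"
proof
  assume "emb_le (sub_emb G S) (sub_emb G S')"
  then obtain H h K k j where hk: "(H, h) \<in> sub_emb G S" "(K, k) \<in> sub_emb G S'"
    "embedding H K j" "gmap_eq H h (gmap_comp k j)"
    unfolding emb_le_def by blast
  have "fst j ` Arc H \<subseteq> Arc K" "snd j ` Vert H \<subseteq> Vert K"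
    using hk(3) by (auto simp: embedding_def dest: etaleD)
  moreover have "fst h ` Arc H = fst k ` fst j ` Arc H" "snd h ` Vert H = snd k ` snd j ` Vert H"
    using hk(4) unfolding gmap_eq_def gmap_comp_def image_image by (auto intro!: image_cong)
  moreover have "img H h = S" "img K k = S'"
    using hk(1,2) by (auto simp: sub_emb_eq[OF T] S S')
  ultimately show "sub_arcs S \<subseteq> sub_arcs S' \<and> sub_verts S \<subseteq> sub_verts S'"
    unfolding img_def by (metis fst_conv image_mono snd_conv)
next
  assume sub: "sub_arcs S \<subseteq> sub_arcs S' \<and> sub_verts S \<subseteq> sub_verts S'"
  obtain H h where h: "(H, h) \<in> sub_emb G S" using sub_emb_nonempty[OF T S] by auto
  obtain K k where k: "(K, k) \<in> sub_emb G S'" using sub_emb_nonempty[OF T S'] by auto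
  have e: "embedding H G h" "img H h = S" "embedding K G k" "img K k = S'"
    using h k by (auto simp: sub_emb_eq[OF T] S S')
  have "\<exists>j. embedding H K j \<and> gmap_eq H h (gmap_comp k j)"
  proof -
    have "fst h ` Arc H \<subseteq> fst k ` Arc K" "snd h ` Vert H \<subseteq> snd k ` Vert K"
      using sub unfolding e(2)[symmetric] e(4)[symmetric] img_def by simp_all
    then show ?thesis using embedding_factor[OF T e(1,3)] by blast
  qed
  then show "emb_le (sub_emb G S) (sub_emb G S')" using h k unfolding emb_le_def by blast
qed

lemma emb_is_edge_sub_emb:
  assumes T: "is_tree G" and S: "S \<in> subtrees G"
  shows "emb_is_edge (sub_emb G S) \<longleftrightarrow> sub_verts S = {}"
proof
  assume "emb_is_edge (sub_emb G S)"
  then obtain H h z where h: "(H, h) \<in> sub_emb G S" "graph_iso H edge_graph z"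
    unfolding emb_is_edge_def by blast
  have "Vert H = {}" using h(2) by (auto simp: graph_iso_def bij_betw_def edge_graph_def)
  moreover have "img H h = S" using h(1) by (auto simp: sub_emb_eq[OF T S])
  ultimately show "sub_verts S = {}" by (auto simp: img_def)
next
  assume V: "sub_verts S = {}"
  obtain H h where h: "(H, h) \<in> sub_emb G S" using sub_emb_nonempty[OF T S] by auto
  then have e: "embedding H G h" "img H h = S" by (auto simp: sub_emb_eq[OF T S])
  then have VH: "Vert H = {}" and con: "connected_graph H"
    using V by (auto simp: img_def embedding_def)
  have GH: "is_graph H" using con by (simp add: connected_graph_def)
  note g = is_graphD[OF GH]
  have att: "Att H = {}" using g(7) VH by blast
  obtain a where a: "Arc H = {a, dag H a}"
    using connected_graph_imp_linked[OF con] VH by (auto simp: linked_def)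
  have d: "dag H a \<noteq> a" "dag H (dag H a) = a" using g(5,6) a by auto
  \<comment> \<open>The remaining arc \<open>dag H a\<close> goes to \<open>False\<close>, in
    agreement with \<open>Not\<close> as the involution of \<open>edge_graph\<close>.\<close>
  define z :: "(nat \<Rightarrow> bool) \<times> (nat \<Rightarrow> unit)" where "z = (\<lambda>b. b = a, \<lambda>_. ())"
  have "is_graph edge_graph" by (simp add: is_graph_def edge_graph_def)
  then have "etale H edge_graph z"
    using GH VH att a d unfolding etale_def involutive_on_def
    by (auto simp: z_def edge_graph_def)
  moreover have "bij_betw (fst z) (Arc H) (Arc edge_graph)"
    using a d by (auto simp: bij_betw_def z_def edge_graph_def inj_on_def)
  ultimately have "graph_iso H edge_graph z"
    using VH att by (simp add: graph_iso_def edge_graph_def bij_betw_def)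
  then show "emb_is_edge (sub_emb G S)" using h unfolding emb_is_edge_def by blast
qed

section \<open>New graph maps between trees\<close>

lemma sub_inter_sel [simp]:
  "sub_arcs (S \<inter>\<^sub>s T) = sub_arcs S \<inter> sub_arcs T" "sub_verts (S \<inter>\<^sub>s T) = sub_verts S \<inter> sub_verts T"
  by (cases S; cases T; simp)+

lemma sub_union_sel [simp]:
  "sub_arcs (S \<union>\<^sub>s T) = sub_arcs S \<union> sub_arcs T" "sub_verts (S \<union>\<^sub>s T) = sub_verts S \<union> sub_verts T"
  by (cases S; cases T; simp)+

lemma subtree_stree:
  "is_tree G \<Longrightarrow> S \<in> subtrees G \<Longrightarrow> stree G (sub_arcs S) (sub_verts S)"
  using subtrees_iff[OF tree_is_graph] by blast

lemma subtree_att: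
  "is_tree G \<Longrightarrow> S \<in> subtrees G \<Longrightarrow> fst (snd S) = atts G (sub_verts S)"
  using subtrees_iff[OF tree_is_graph, of G S] by (metis fst_conv snd_conv)

lemma subtreeI:
  "is_tree G \<Longrightarrow> stree G A V \<Longrightarrow> (A, atts G V, V) \<in> subtrees G"
  using subtrees_iff[OF tree_is_graph, of G "(A, atts G V, V)"] by simp

lemma subtree_eqI:
  assumes T: "is_tree G" and S: "S \<in> subtrees G" and S': "S' \<in> subtrees G"
    and "sub_arcs S \<subseteq> sub_arcs S'" "sub_verts S = sub_verts S'"
  shows "S = S'"
proof -
  have "stree G (sub_arcs S) (sub_verts S')" using subtree_stree[OF T S] assms(5) by simp
  then have "sub_arcs S = sub_arcs S'"
    using stree_eqI[OF tree_is_graph[OF T] _ subtree_stree[OF T S'] assms(4)] by blast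
  then show ?thesis using subtree_att[OF T S] subtree_att[OF T S'] assms(5) by (simp add: prod_eq_iff)
qed

text \<open>The middle component adds nothing: an arc attached in both subtrees has its target in
  both.\<close>

lemma overlap_iff:
  assumes "is_tree G" "S \<in> subtrees G" "T \<in> subtrees G"
  shows "overlap S T \<longleftrightarrow>
    sub_arcs S \<inter> sub_arcs T \<noteq> {} \<or> sub_verts S \<inter> sub_verts T \<noteq> {}"
proof -
  have "fst (snd (S \<inter>\<^sub>s T)) = atts G (sub_verts S) \<inter> atts G (sub_verts T)"
    using subtree_att[OF assms(1,2)] subtree_att[OF assms(1,3)] by (cases S; cases T) auto
  then have "sub_verts S \<inter> sub_verts T = {} \<Longrightarrow> fst (snd (S \<inter>\<^sub>s T)) = {}"
    by (auto simp: atts_def)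
  then show ?thesis unfolding overlap_def by (auto simp: prod_eq_iff)
qed

lemma sub_inter_subtree:
  assumes "is_tree G" "S \<in> subtrees G" "T \<in> subtrees G" "overlap S T"
  shows "S \<inter>\<^sub>s T \<in> subtrees G"
proof -
  have "stree G (sub_arcs S \<inter> sub_arcs T) (sub_verts S \<inter> sub_verts T)"
    using stree_Int assms overlap_iff subtree_stree by metis
  moreover have "S \<inter>\<^sub>s T = (sub_arcs S \<inter> sub_arcs T, atts G (sub_verts S \<inter> sub_verts T),
      sub_verts S \<inter> sub_verts T)"
    using subtree_att[OF assms(1,2)] subtree_att[OF assms(1,3)]
    by (cases S; cases T) (auto simp: atts_def)
  ultimately show ?thesis using subtreeI[OF assms(1)] by metis
qed

lemma sub_union_subtree:
  assumes "is_tree G" "S \<in> subtrees G" "T \<in> subtrees G" "overlap S T"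
  shows "S \<union>\<^sub>s T \<in> subtrees G"
proof -
  have "stree G (sub_arcs S \<union> sub_arcs T) (sub_verts S \<union> sub_verts T)"
    using stree_Un tree_is_graph assms overlap_iff subtree_stree by metis
  moreover have "S \<union>\<^sub>s T = (sub_arcs S \<union> sub_arcs T, atts G (sub_verts S \<union> sub_verts T),
      sub_verts S \<union> sub_verts T)"
    using subtree_att[OF assms(1,2)] subtree_att[OF assms(1,3)]
    by (cases S; cases T) (auto simp: atts_def)
  ultimately show ?thesis using subtreeI[OF assms(1)] by metis
qed

lemma emb_is_union_sub_emb:
  assumes T: "is_tree G" and sub: "S \<in> subtrees G" "S' \<in> subtrees G" "U \<in> subtrees G"
  shows "emb_is_union (sub_emb G U) (sub_emb G S) (sub_emb G S') \<longleftrightarrow>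
    overlap S S' \<and> U = S \<union>\<^sub>s S'"
proof
  assume "emb_is_union (sub_emb G U) (sub_emb G S) (sub_emb G S')"
  then have le: "sub_arcs S \<subseteq> sub_arcs U" "sub_arcs S' \<subseteq> sub_arcs U"
    and V: "sub_verts U = sub_verts S \<union> sub_verts S'"
    by (simp_all add: emb_is_union_def emb_le_sub_emb[OF T] emb_verts_sub_emb[OF T] sub)
  have U: "stree G (sub_arcs U) (sub_verts S \<union> sub_verts S')"
    using subtree_stree[OF T sub(3)] V by simp
  note un = stree_union_unique[OF tree_is_graph[OF T] subtree_stree[OF T sub(1)]
      subtree_stree[OF T sub(2)] U le]
  have ov: "overlap S S'" using overlap_iff[OF T sub(1,2)] un(1) by blast
  then have "S \<union>\<^sub>s S' = U"
    using subtree_eqI[OF T sub_union_subtree[OF T sub(1,2)] sub(3)] un(2) V by simp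
  then show "overlap S S' \<and> U = S \<union>\<^sub>s S'" using ov by simp
next
  assume "overlap S S' \<and> U = S \<union>\<^sub>s S'"
  then show "emb_is_union (sub_emb G U) (sub_emb G S) (sub_emb G S')"
    using sub by (simp add: emb_is_union_def emb_le_sub_emb[OF T] emb_verts_sub_emb[OF T])
qed

definition star_sub :: "('a, 'v) graph_data \<Rightarrow> 'v \<Rightarrow> ('a, 'v) sub" where
  "star_sub G v = (star G v, atts G {v}, {v})"

lemma star_sub_subtree:
  "is_tree G \<Longrightarrow> v \<in> Vert G \<Longrightarrow> star_sub G v \<in> subtrees G"
  unfolding star_sub_def by (intro subtreeI stree_star tree_is_graph)

section \<open>Both implications, for a function on subtrees that sends edges to edges\<close>

context
  fixes G :: "('a, 'v) graph_data" and G' :: "('b, 'w) graph_data"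
    and F :: "('a, 'v) sub \<Rightarrow> ('b, 'w) sub"
  assumes T: "is_tree G" and T': "is_tree G'"
    and F: "\<And>S. S \<in> subtrees G \<Longrightarrow> F S \<in> subtrees G'"
    and edge: "\<And>S. S \<in> subtrees G \<Longrightarrow> sub_verts S = {} \<Longrightarrow> sub_verts (F S) = {}"
begin

lemma vertex_disjoint_preserved:
  assumes pres: "\<And>S T. S \<in> subtrees G \<Longrightarrow> T \<in> subtrees G \<Longrightarrow> overlap S T \<Longrightarrow>
      F (S \<inter>\<^sub>s T) = F S \<inter>\<^sub>s F T \<and> F (S \<union>\<^sub>s T) = F S \<union>\<^sub>s F T"
    and S: "S \<in> subtrees G" and S': "S' \<in> subtrees G"
    and disj: "sub_verts S \<inter> sub_verts S' = {}"
  shows "sub_verts (F S) \<inter> sub_verts (F S') = {}"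
proof -
  note G = tree_is_graph[OF T]
  \<comment> \<open>Vertex disjoint subtrees that overlap meet in an edge; by (a) the intersection
    of their images is the image of that edge.\<close>
  have meet: "sub_verts (F R) \<inter> sub_verts (F S') = {}"
    if R: "R \<in> subtrees G" "sub_verts R \<inter> sub_verts S' = {}" "overlap R S'" for R
    using edge[OF sub_inter_subtree[OF T R(1) S' R(3)]] pres[OF R(1) S' R(3)] R(2)
    by (metis sub_inter_sel(2))
  let ?B = "sub_arcs S'" and ?W = "sub_verts S'"
  have con: "connected_graph G" using T by (simp add: is_tree_def)
  have sS: "stree G (sub_arcs S) (sub_verts S)" and sS': "stree G ?B ?W"
    using subtree_stree[OF T] S S' by auto
  \<comment> \<open>Either \<open>C\<close> has not yet met \<open>S'\<close>, or the goal already
    holds. At the whole tree the first alternative is impossible.\<close>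
  define P where "P C U \<longleftrightarrow>
    C \<inter> ?B = {} \<and> U \<inter> ?W = {} \<or> sub_verts (F S) \<inter> sub_verts (F S') = {}" for C U
  have "P (Arc G) (Vert G)"
  proof (rule stree_induct[OF G sS stree_whole[OF con]])
    show "sub_arcs S \<subseteq> Arc G" "sub_verts S \<subseteq> Vert G" using sS by (auto dest: streeD)
    show "P (sub_arcs S) (sub_verts S)"
      using meet[OF S disj] overlap_iff[OF T S S'] by (auto simp: P_def)
  next
    fix C U v a
    assume C: "stree G C U" "sub_arcs S \<subseteq> C" "sub_verts S \<subseteq> U" "P C U"
      and v: "v \<in> Vert G" "v \<notin> U" "a \<in> C" "a \<in> nb G v"
    show "P (C \<union> star G v) (insert v U)"
    proof (cases "sub_verts (F S) \<inter> sub_verts (F S') = {}")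
      case False
      then have d: "C \<inter> ?B = {}" "U \<inter> ?W = {}" using C(4) by (auto simp: P_def)
      have "a \<in> star G v" using v by (simp add: star_def)
      \<comment> \<open>A vertex of \<open>S'\<close> brings its whole star, hence \<open>a\<close>,
        into \<open>S'\<close>, but \<open>C\<close> contains \<open>a\<close> and misses
        \<open>S'\<close>. So the first contact with \<open>S'\<close> shares arcs and no
        vertex.\<close>
      then have vW: "v \<notin> ?W" using star_subset[OF sS', of v] v d by auto
      have st: "stree G (C \<union> star G v) (insert v U)"
        using stree_Un[OF G C(1) stree_star[OF G v(1)]] v \<open>a \<in> star G v\<close> by auto
      define R where "R = (C \<union> star G v, atts G (insert v U), insert v U)"
      have R: "R \<in> subtrees G" "sub_arcs R = C \<union> star G v" "sub_verts R = insert v U"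
        using subtreeI[OF T st] by (simp_all add: R_def)
      have ov: "overlap S R"
        using stree_nonempty[OF sS] C(2,3) by (auto simp: overlap_iff[OF T S R(1)] R)
      \<comment> \<open>Writing an inclusion as an absorbed union turns (b) into monotonicity of
        \<open>F\<close>.\<close>
      have "R = S \<union>\<^sub>s R"
        by (rule subtree_eqI[OF T R(1) sub_union_subtree[OF T S R(1) ov]]) (use C(2,3) R in auto)
      then have "F R = F S \<union>\<^sub>s F R" using pres[OF S R(1) ov] by simp
      then have "sub_verts (F S) \<subseteq> sub_verts (F R)" by (metis sub_union_sel(2) Un_upper1)
      then have "\<not> overlap R S'" using meet[OF R(1)] R(3) d(2) vW False by auto
      then show ?thesis using overlap_iff[OF T R(1) S'] R by (simp add: P_def)
    qed (simp add: P_def)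
  qed
  then show ?thesis
    using stree_nonempty[OF sS'] streeD(1,2)[OF sS'] by (auto simp: P_def)
qed

text \<open>Equality of vertices is not enough when the intersection is an edge, as it does not
  identify that edge. Monotonicity supplies an inclusion of arcs, and \<open>subtree_eqI\<close>
  concludes.\<close>

lemma inter_preserved:
  assumes un: "\<And>S T. S \<in> subtrees G \<Longrightarrow> T \<in> subtrees G \<Longrightarrow> overlap S T \<Longrightarrow>
      overlap (F S) (F T) \<and> F (S \<union>\<^sub>s T) = F S \<union>\<^sub>s F T"
    and disj: "\<And>S T. S \<in> subtrees G \<Longrightarrow> T \<in> subtrees G \<Longrightarrow> sub_verts S \<inter> sub_verts T = {} \<Longrightarrow>
      sub_verts (F S) \<inter> sub_verts (F T) = {}"
    and S: "S \<in> subtrees G" and S': "S' \<in> subtrees G" and ov: "overlap S S'"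
  shows "F (S \<inter>\<^sub>s S') = F S \<inter>\<^sub>s F S'"
proof -
  note G = tree_is_graph[OF T]
  \<comment> \<open>Additivity over stars, obtained by growing \<open>R\<close>; for an edge both
    sides are empty.\<close>
  have verts: "sub_verts (F R) = (\<Union>v\<in>sub_verts R. sub_verts (F (star_sub G v)))"
    if R: "R \<in> subtrees G" for R
  proof (cases "sub_verts R = {}")
    case False
    note sR = subtree_stree[OF T R]
    define P where "P C U \<longleftrightarrow> sub_verts (F (C, atts G U, U)) =
      (\<Union>v\<in>U. sub_verts (F (star_sub G v)))" for C U
    obtain v0 where v0: "v0 \<in> sub_verts R" using False by auto
    have v0G: "v0 \<in> Vert G" using v0 streeD(2)[OF sR] by auto
    have "P (sub_arcs R) (sub_verts R)"
    proof (rule stree_induct[OF G stree_star[OF G v0G] sR])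
      show "star G v0 \<subseteq> sub_arcs R" "{v0} \<subseteq> sub_verts R" using star_subset[OF sR v0] v0 by auto
      show "P (star G v0) {v0}" by (simp add: P_def star_sub_def)
    next
      fix C U v a
      assume C: "stree G C U" "P C U" and v: "v \<in> sub_verts R" "v \<notin> U" "a \<in> C" "a \<in> nb G v"
      have vG: "v \<in> Vert G" using v streeD(2)[OF sR] by auto
      let ?C = "(C, atts G U, U)"
      have C': "?C \<in> subtrees G" and st: "star_sub G v \<in> subtrees G"
        using subtreeI[OF T C(1)] star_sub_subtree[OF T vG] by auto
      have "overlap ?C (star_sub G v)"
        using v unfolding overlap_iff[OF T C' st] by (auto simp: star_sub_def star_def)
      then have "F (?C \<union>\<^sub>s star_sub G v) = F ?C \<union>\<^sub>s F (star_sub G v)" using un[OF C' st] by simp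
      moreover have "?C \<union>\<^sub>s star_sub G v = (C \<union> star G v, atts G (insert v U), insert v U)"
        by (auto simp: star_sub_def atts_def)
      ultimately show "P (C \<union> star G v) (insert v U)"
        using C(2) unfolding P_def by (simp del: sub_union.simps add: Un_commute)
    qed
    moreover have "(sub_arcs R, atts G (sub_verts R), sub_verts R) = R"
      using subtree_att[OF T R] by (simp add: prod_eq_iff)
    ultimately show ?thesis by (simp add: P_def)
  qed (use edge[OF R] in auto)
  have mono: "sub_arcs (F R) \<subseteq> sub_arcs (F R')"
    if R: "R \<in> subtrees G" "R' \<in> subtrees G" and le: "sub_arcs R \<subseteq> sub_arcs R'" "sub_verts R \<subseteq> sub_verts R'"
    for R R'
  proof -
    have ov: "overlap R R'"
      using stree_nonempty[OF subtree_stree[OF T R(1)]] le by (auto simp: overlap_iff[OF T R])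
    have "R' = R \<union>\<^sub>s R'"
      by (rule subtree_eqI[OF T R(2) sub_union_subtree[OF T R ov]]) (use le in auto)
    then have "F R' = F R \<union>\<^sub>s F R'" using un[OF R ov] by simp
    then show ?thesis by (metis sub_union_sel(1) Un_upper1)
  qed
  have I: "S \<inter>\<^sub>s S' \<in> subtrees G" using sub_inter_subtree[OF T S S' ov] .
  have I': "F S \<inter>\<^sub>s F S' \<in> subtrees G'"
    using sub_inter_subtree[OF T' F[OF S] F[OF S']] un[OF S S' ov] by simp
  have VG: "sub_verts S \<subseteq> Vert G" "sub_verts S' \<subseteq> Vert G"
    using streeD(2) subtree_stree[OF T] S S' by blast+
  \<comment> \<open>A vertex of the target lies over at most one star, so one that lies in the
    images of both \<open>S\<close> and \<open>S'\<close> comes from a common vertex.\<close>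
  have "u = v" if "u \<in> Vert G" "v \<in> Vert G" "w \<in> sub_verts (F (star_sub G u))"
    "w \<in> sub_verts (F (star_sub G v))" for u v w
    using disj[OF star_sub_subtree[OF T that(1)] star_sub_subtree[OF T that(2)]] that(3,4)
    by (auto simp: star_sub_def)
  then have "sub_verts (F (S \<inter>\<^sub>s S')) = sub_verts (F S \<inter>\<^sub>s F S')"
    using VG unfolding verts[OF I] sub_inter_sel verts[OF S] verts[OF S'] by blast
  moreover have "sub_arcs (F (S \<inter>\<^sub>s S')) \<subseteq> sub_arcs (F S \<inter>\<^sub>s F S')"
    using mono[OF I S] mono[OF I S'] by simp
  ultimately show ?thesis using subtree_eqI[OF T' F[OF I] I'] by blast
qed

end

text \<open>By involutivity some arc and its mate both lie on the boundary of \<open>R\<close>. A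
  subtree with vertices has no such pair, since each of its edges has an attached arc.\<close>

lemma edge_preserved:
  assumes T: "is_tree G" and T': "is_tree G'" and inv: "involutive_on G G' \<phi>\<^sub>0"
    and S: "S \<in> subtrees G" and R: "R \<in> subtrees G'"
    and bd: "mset_set (emb_bdry (sub_emb G' R)) = image_mset \<phi>\<^sub>0 (mset_set (emb_bdry (sub_emb G S)))"
    and V: "sub_verts S = {}"
  shows "sub_verts R = {}"
proof (rule ccontr)
  assume "sub_verts R \<noteq> {}"
  note sS = subtree_stree[OF T S] and sR = subtree_stree[OF T' R]
  obtain a where a: "sub_arcs S = {a, dag G a}" using streeD(6)[OF sS V] by auto
  then have aG: "a \<in> Arc G" using streeD(1)[OF sS] by auto
  have "emb_bdry (sub_emb G S) = {a, dag G a}"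
    using a V by (simp add: emb_bdry_sub_emb[OF T S] atts_def)
  then have "set_mset (mset_set (emb_bdry (sub_emb G' R))) = {\<phi>\<^sub>0 a, \<phi>\<^sub>0 (dag G a)}"
    using bd by simp
  \<comment> \<open>\<open>mset_set\<close> is empty on infinite sets; the inclusion holds in either
    case.\<close>
  moreover have "set_mset (mset_set B) \<subseteq> B" for B :: "'c set"
    by (cases "finite B") auto
  ultimately have "\<phi>\<^sub>0 a \<in> emb_bdry (sub_emb G' R)" "dag G' (\<phi>\<^sub>0 a) \<in> emb_bdry (sub_emb G' R)"
    using inv aG unfolding involutive_on_def by (metis insertI1 insertI2 subsetD)+
  then show False
    using streeD(7)[OF sR \<open>sub_verts R \<noteq> {}\<close>] by (auto simp: emb_bdry_sub_emb[OF T' R])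
qed

theorem theoremA7:
  fixes G :: "('a, 'v) graph_data" and G' :: "('b, 'w) graph_data"
    and \<phi>\<^sub>0 :: "'a \<Rightarrow> 'b" and \<phi> :: "('a, 'v) emb \<Rightarrow> ('b, 'w) emb"
  assumes "is_tree G" and "is_tree G'"
    and "involutive_on G G' \<phi>\<^sub>0"
    and "\<phi> \<in> Emb G \<rightarrow> Emb G'"
    and "\<forall>h\<in>Emb G. mset_set (emb_bdry (\<phi> h)) = image_mset \<phi>\<^sub>0 (mset_set (emb_bdry h))"
  shows "new_graph_map G G' (\<phi>\<^sub>0, \<phi>) \<longleftrightarrow>
    (\<forall>S\<in>subtrees G. \<forall>T\<in>subtrees G. overlap S T \<longrightarrow>
       overlap (on_subtrees G G' \<phi> S) (on_subtrees G G' \<phi> T) \<and>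
       on_subtrees G G' \<phi> (S \<inter>\<^sub>s T) = on_subtrees G G' \<phi> S \<inter>\<^sub>s on_subtrees G G' \<phi> T \<and>
       on_subtrees G G' \<phi> (S \<union>\<^sub>s T) = on_subtrees G G' \<phi> S \<union>\<^sub>s on_subtrees G G' \<phi> T)"
proof -
  note T = assms(1) and T' = assms(2)
  note b = bij_betw_sub_emb[OF T] and b' = bij_betw_sub_emb[OF T']
  let ?F = "on_subtrees G G' \<phi>"
  have emb: "sub_emb G S \<in> Emb G" if "S \<in> subtrees G" for S
    using b that by (rule bij_betw_apply)
  have \<phi>S: "\<phi> (sub_emb G S) \<in> Emb G'" if "S \<in> subtrees G" for S
    using emb[OF that] assms(4) by blast
  have F: "?F S \<in> subtrees G'" if "S \<in> subtrees G" for S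
    using bij_betw_apply[OF bij_betw_the_inv_into[OF b'] \<phi>S[OF that]]
    by (simp add: on_subtrees_def)
  have \<phi>F: "\<phi> (sub_emb G S) = sub_emb G' (?F S)" if "S \<in> subtrees G" for S
    using f_the_inv_into_f_bij_betw[OF b', of "\<phi> (sub_emb G S)"] \<phi>S[OF that]
    by (simp add: on_subtrees_def)
  have edge: "sub_verts (?F S) = {}" if S: "S \<in> subtrees G" and V: "sub_verts S = {}" for S
  proof (rule edge_preserved[OF T T' assms(3) S F[OF S] _ V])
    show "mset_set (emb_bdry (sub_emb G' (?F S))) =
        image_mset \<phi>\<^sub>0 (mset_set (emb_bdry (sub_emb G S)))"
      using assms(5) emb[OF S] \<phi>F[OF S] by metis
  qed
  have Emb: "(\<forall>h\<in>Emb G. Q h) \<longleftrightarrow> (\<forall>S\<in>subtrees G. Q (sub_emb G S))" for Q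
    unfolding bij_betw_imp_surj_on[OF b, symmetric] by blast
  have union: "emb_is_union (sub_emb G U) (sub_emb G S) (sub_emb G R) \<longleftrightarrow>
      overlap S R \<and> U = S \<union>\<^sub>s R"
    "emb_is_union (\<phi> (sub_emb G U)) (\<phi> (sub_emb G S)) (\<phi> (sub_emb G R)) \<longleftrightarrow>
      overlap (?F S) (?F R) \<and> ?F U = ?F S \<union>\<^sub>s ?F R"
    if "S \<in> subtrees G" "R \<in> subtrees G" "U \<in> subtrees G" for S R U
    using that by (simp_all add: \<phi>F F emb_is_union_sub_emb[OF T] emb_is_union_sub_emb[OF T'])
  have disjoint: "emb_vertex_disjoint (sub_emb G S) (sub_emb G R) \<longleftrightarrow>
      sub_verts S \<inter> sub_verts R = {}"
    "emb_vertex_disjoint (\<phi> (sub_emb G S)) (\<phi> (sub_emb G R)) \<longleftrightarrow>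
      sub_verts (?F S) \<inter> sub_verts (?F R) = {}"
    if "S \<in> subtrees G" "R \<in> subtrees G" for S R
    using that by (simp_all add: \<phi>F F emb_vertex_disjoint_def emb_verts_sub_emb[OF T]
        emb_verts_sub_emb[OF T'])
  have is_edge: "emb_is_edge (sub_emb G S) \<longrightarrow> emb_is_edge (\<phi> (sub_emb G S))"
    if "S \<in> subtrees G" for S
    using edge[OF that] that
    by (simp add: \<phi>F F emb_is_edge_sub_emb[OF T] emb_is_edge_sub_emb[OF T'])
  \<comment> \<open>With the boundary condition given, and edges going to edges because of it, only
    unions and vertex disjointness remain, both expressed through subtrees.\<close>
  have new_iff: "new_graph_map G G' (\<phi>\<^sub>0, \<phi>) \<longleftrightarrow>
    (\<forall>U\<in>subtrees G. \<forall>S\<in>subtrees G. \<forall>R\<in>subtrees G.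
       overlap S R \<and> U = S \<union>\<^sub>s R \<longrightarrow> overlap (?F S) (?F R) \<and> ?F U = ?F S \<union>\<^sub>s ?F R) \<and>
    (\<forall>S\<in>subtrees G. \<forall>R\<in>subtrees G.
       sub_verts S \<inter> sub_verts R = {} \<longrightarrow> sub_verts (?F S) \<inter> sub_verts (?F R) = {})"
    (is "_ \<longleftrightarrow> ?union \<and> ?disj")
  proof -
    have "new_graph_map G G' (\<phi>\<^sub>0, \<phi>) \<longleftrightarrow>
      (\<forall>l\<in>Emb G. \<forall>h\<in>Emb G. \<forall>k\<in>Emb G.
        emb_is_union l h k \<longrightarrow> emb_is_union (\<phi> l) (\<phi> h) (\<phi> k)) \<and>
      (\<forall>h\<in>Emb G. \<forall>k\<in>Emb G. emb_vertex_disjoint h k \<longrightarrow> emb_vertex_disjoint (\<phi> h) (\<phi> k))"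
      using assms(3-5) is_edge Emb[of "\<lambda>h. emb_is_edge h \<longrightarrow> emb_is_edge (\<phi> h)"]
      unfolding new_graph_map_def bdry_compatible_def fst_conv snd_conv by blast
    also have "\<dots> \<longleftrightarrow> ?union \<and> ?disj"
      unfolding Emb by (intro arg_cong2[of _ _ _ _ conj] ball_cong refl) (simp_all only: union disjoint)
    finally show ?thesis .
  qed
  show ?thesis
  proof
    assume new: "new_graph_map G G' (\<phi>\<^sub>0, \<phi>)"
    have un: "overlap (?F S) (?F R) \<and> ?F (S \<union>\<^sub>s R) = ?F S \<union>\<^sub>s ?F R"
      if "S \<in> subtrees G" "R \<in> subtrees G" "overlap S R" for S R
      using that new[unfolded new_iff] sub_union_subtree[OF T that] by blast
    have disj: "sub_verts (?F S) \<inter> sub_verts (?F R) = {}"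
      if "S \<in> subtrees G" "R \<in> subtrees G" "sub_verts S \<inter> sub_verts R = {}" for S R
      using that new[unfolded new_iff] by blast
    show "\<forall>S\<in>subtrees G. \<forall>R\<in>subtrees G. overlap S R \<longrightarrow> overlap (?F S) (?F R) \<and>
       ?F (S \<inter>\<^sub>s R) = ?F S \<inter>\<^sub>s ?F R \<and> ?F (S \<union>\<^sub>s R) = ?F S \<union>\<^sub>s ?F R"
      using un inter_preserved[where F = ?F, OF T T' F edge un disj] by blast
  next
    assume pres: "\<forall>S\<in>subtrees G. \<forall>R\<in>subtrees G. overlap S R \<longrightarrow> overlap (?F S) (?F R) \<and>
       ?F (S \<inter>\<^sub>s R) = ?F S \<inter>\<^sub>s ?F R \<and> ?F (S \<union>\<^sub>s R) = ?F S \<union>\<^sub>s ?F R"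
    have "sub_verts (?F S) \<inter> sub_verts (?F R) = {}"
      if "S \<in> subtrees G" "R \<in> subtrees G" "sub_verts S \<inter> sub_verts R = {}" for S R
    proof (rule vertex_disjoint_preserved[where F = ?F, OF T T' F edge _ that])
      show "?F (S \<inter>\<^sub>s R) = ?F S \<inter>\<^sub>s ?F R \<and> ?F (S \<union>\<^sub>s R) = ?F S \<union>\<^sub>s ?F R"
        if "S \<in> subtrees G" "R \<in> subtrees G" "overlap S R" for S R
        using pres that by blast
    qed
    then show "new_graph_map G G' (\<phi>\<^sub>0, \<phi>)" unfolding new_iff using pres by blast
  qed
qed

end
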